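(* Let $\mathcal{S}$ be a small category admitting binary products, with subcategories $\mathcal{S}^{sm}$ (smooth morphisms) and $\mathcal{S}^{cl}$ (closed immersions) satisfying conditions (i)--(iv) listed in the context, and let $\mathbb{H}$ be an $\mathcal{S}$-fibered category. Then every external tensor structure on $\mathbb{H}$ determines, by restriction to $\mathcal{S}^{sm}$ and $\mathcal{S}^{cl}$, an external tensor skeleton on $\mathbb{H}$. Conversely, every external tensor skeleton on $\mathbb{H}$ extends uniquely to an external tensor structure on $\mathbb{H}$. Moreover, if $\mathbb{H}$ is smooth-adjointable, then a given external tensor structure on $\mathbb{H}$ is smooth-adjointable if and only if the underlying external tensor skeleton is smooth-adjointable.
   Context: Standing assumptions on $\mathcal{S}$: $\mathcal{S}$ has two (possibly non-full) subcategories $\mathcal{S}^{sm},\mathcal{S}^{cl}$ such that: (i) both have the same objects as $\mathcal{S}$ and contain all isomorphisms; (ii) for every $p:P\to S$ in $\mathcal{S}^{sm}$ and every $f:T\to S$ in $\mathcal{S}$ the fibered product $P\times_S T$ exists, and every base change of a morphism of $\mathcal{S}^{sm}$ lies in $\mathcal{S}^{sm}$; (iii) in every Cartesian square with sides $z':P_Z\to P$, $p':P_Z\to Z$, $p:P\to S$ in $\mathcal{S}^{sm}$, $z:Z\to S$ in $\mathcal{S}^{cl}$, the morphism $z'$ is in $\mathcal{S}^{cl}$; and if $gz$ is in $\mathcal{S}^{cl}$ then $z$ is in $\mathcal{S}^{cl}$; (iv) every morphism $f$ of $\mathcal{S}$ factors as $f=p\circ t$ with $t$ in $\mathcal{S}^{cl}$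 and $p$ in $\mathcal{S}^{sm}$. An $\mathcal{S}$-fibered category $\mathbb{H}$: categories $\mathbb{H}(S)$, functors $f^*:\mathbb{H}(S)\to\mathbb{H}(T)$ for $f:T\to S$, and natural isomorphisms $\mathrm{conn}_{f,g}:(gf)^*A\xrightarrow{\sim}f^*g^*A$ with $\mathrm{id}_S^*=\mathrm{id}$ and $f^*\mathrm{conn}_{g,h}\circ\mathrm{conn}_{f,hg}=\mathrm{conn}_{f,g}\circ\mathrm{conn}_{gf,h}$. Composites of connection isomorphisms are coherent and are written as equalities. For a subcategory $\mathcal{S}'$, $\mathbb{H}$ restricts to an $\mathcal{S}'$-fibered category; write $\mathbb{H}^{sm},\mathbb{H}^{cl}$ for the restrictions to $\mathcal{S}^{sm},\mathcal{S}^{cl}$. For $\mathcal{S}'=\mathcal{S},\mathcal{S}^{sm},\mathcal{S}^{cl}$, an external tensor structure $(\boxtimes,m)$ on (the restriction to $\mathcal{S}'$ of) $\mathbb{H}$ consists of functors $-\boxtimes-:\mathbb{H}(S_1)\times\mathbb{H}(S_2)\to\mathbb{H}(S_1\times S_2)$ for all $S_1,S_2\in\mathcal{S}$, and natural isomorphisms $m_{f_1,f_2}:f_1^*A_1\boxtimes f_2^*A_2\xrightarrow{\sim}(f_1\times f_2)^*(A_1\boxtimes A_2)$ for all $f_i:T_i\to S_i$ in $\mathcal{S}'$, $i=1,2$ (products formed in $\mathcal{S}$), such that for composable $f_i:T_i\to S_i$, $g_i:S_i\to V_i$ in $\mathcal{S}'$ the isomorphism $m_{g_1f_1,g_2f_2}$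 coincides, modulo connection isomorphisms, with $f_1^*g_1^*A_1\boxtimes f_2^*g_2^*A_2\xrightarrow{m_{f_1,f_2}}(f_1\times f_2)^*(g_1^*A_1\boxtimes g_2^*A_2)\xrightarrow{m_{g_1,g_2}}(f_1\times f_2)^*(g_1\times g_2)^*(A_1\boxtimes A_2)$. An external tensor skeleton $(\boxtimes,m^{sm},m^{cl})$ on $\mathbb{H}$ consists of external tensor structures $(\boxtimes,m^{sm})$ on $\mathbb{H}^{sm}$ and $(\boxtimes,m^{cl})$ on $\mathbb{H}^{cl}$, with the same functors $\boxtimes$, such that for every pair of commutative squares $p_ih_i=z_iq_i$ ($i=1,2$) with $h_i:Q_i\to P_i$, $q_i:Q_i\to Z_i$, $p_i:P_i\to S_i$, $z_i:Z_i\to S_i$, $p_i,q_i$ smooth and $z_i,h_i$ closed immersions, the composites $$q_1^*z_1^*A_1\boxtimes q_2^*z_2^*A_2\xrightarrow{m^{sm}}(q_1\times q_2)^*(z_1^*A_1\boxtimes z_2^*A_2)\xrightarrow{m^{cl}}(q_1\times q_2)^*(z_1\times z_2)^*(A_1\boxtimes A_2),$$ $$h_1^*p_1^*A_1\boxtimes h_2^*p_2^*A_2\xrightarrow{m^{cl}}(h_1\times h_2)^*(p_1^*A_1\boxtimes p_2^*A_2)\xrightarrow{m^{sm}}(h_1\times h_2)^*(p_1\times p_2)^*(A_1\boxtimes A_2)$$ coincide modulo connection isomorphisms. $\mathbb{H}$ is smooth-adjointable if $p^*$ has a left adjoint $p_\#$ for every smooth $p$. In that case, an external tensor structure $(\boxtimes,m)$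 on $\mathbb{H}$ or $\mathbb{H}^{sm}$ is smooth-adjointable if for all smooth $p_i:P_i\to S_i$ ($i=1,2$) the composite $(p_1\times p_2)_\#(A_1\boxtimes A_2)\xrightarrow{\eta}(p_1\times p_2)_\#(p_1^*p_{1,\#}A_1\boxtimes p_2^*p_{2,\#}A_2)\xrightarrow{m}(p_1\times p_2)_\#(p_1\times p_2)^*(p_{1,\#}A_1\boxtimes p_{2,\#}A_2)\xrightarrow{\epsilon}p_{1,\#}A_1\boxtimes p_{2,\#}A_2$ is invertible; a skeleton $(\boxtimes,m^{sm},m^{cl})$ is smooth-adjointable if $(\boxtimes,m^{sm})$ is. *)

theory Defs
  imports Main
begin

section \<open>Categories, functors, natural isomorphisms, adjunctions\<close>

record ('o, 'a) cat =
  Ob :: "'o set"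
  Ar :: "'a set"
  Dom :: "'a \<Rightarrow> 'o"
  Cod :: "'a \<Rightarrow> 'o"
  Idt :: "'o \<Rightarrow> 'a"
  Comp :: "'a \<Rightarrow> 'a \<Rightarrow> 'a" (infixr "\<cdot>\<index>" 70)

definition Hom :: "('o, 'a) cat \<Rightarrow> 'o \<Rightarrow> 'o \<Rightarrow> 'a set" where
  "Hom C A B = {f \<in> Ar C. Dom C f = A \<and> Cod C f = B}"

locale category =
  fixes C :: "('o, 'a) cat" (structure)
  assumes Dom_Ob: "f \<in> Ar C \<Longrightarrow> Dom C f \<in> Ob C"
    and Cod_Ob: "f \<in> Ar C \<Longrightarrow> Cod C f \<in> Ob C"
    and Idt_Hom: "A \<in> Ob C \<Longrightarrow> Idt C A \<in> Hom C A A"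
    and Comp_Hom: "f \<in> Hom C A B \<Longrightarrow> g \<in> Hom C B D \<Longrightarrow> g \<cdot> f \<in> Hom C A D"
    and Comp_Idt: "f \<in> Hom C A B \<Longrightarrow> f \<cdot> Idt C A = f"
    and Idt_Comp: "f \<in> Hom C A B \<Longrightarrow> Idt C B \<cdot> f = f"
    and Comp_assoc: "f \<in> Hom C A B \<Longrightarrow> g \<in> Hom C B D \<Longrightarrow> h \<in> Hom C D E
      \<Longrightarrow> (h \<cdot> g) \<cdot> f = h \<cdot> (g \<cdot> f)"

definition inverse_arrows :: "('o, 'a) cat \<Rightarrow> 'a \<Rightarrow> 'a \<Rightarrow> bool" where
  "inverse_arrows C f g \<longleftrightarrow> f \<in> Ar C \<and> g \<in> Hom C (Cod C f) (Dom C f) \<and>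
     g \<cdot>\<^bsub>C\<^esub> f = Idt C (Dom C f) \<and> f \<cdot>\<^bsub>C\<^esub> g = Idt C (Cod C f)"

definition is_iso :: "('o, 'a) cat \<Rightarrow> 'a \<Rightarrow> bool" where
  "is_iso C f \<longleftrightarrow> (\<exists>g. inverse_arrows C f g)"

definition inv_ar :: "('o, 'a) cat \<Rightarrow> 'a \<Rightarrow> 'a" where
  "inv_ar C f = (THE g. inverse_arrows C f g)"

definition prod_cat :: "('o, 'a) cat \<Rightarrow> ('p, 'b) cat \<Rightarrow> ('o \<times> 'p, 'a \<times> 'b) cat" where
  "prod_cat C D =
    \<lparr> Ob = Ob C \<times> Ob D, Ar = Ar C \<times> Ar D,
      Dom = map_prod (Dom C) (Dom D), Cod = map_prod (Cod C) (Cod D),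
      Idt = map_prod (Idt C) (Idt D),
      Comp = (\<lambda>(g, g') (f, f'). (g \<cdot>\<^bsub>C\<^esub> f, g' \<cdot>\<^bsub>D\<^esub> f')) \<rparr>"

record ('o, 'a, 'p, 'b) functr =
  fob :: "'o \<Rightarrow> 'p"
  far :: "'a \<Rightarrow> 'b"

locale is_functor =
  fixes C :: "('o, 'a) cat" and D :: "('p, 'b) cat" and F :: "('o, 'a, 'p, 'b) functr"
  assumes fob_Ob: "A \<in> Ob C \<Longrightarrow> fob F A \<in> Ob D"
    and far_Hom: "f \<in> Hom C A B \<Longrightarrow> far F f \<in> Hom D (fob F A) (fob F B)"
    and far_Idt: "A \<in> Ob C \<Longrightarrow> far F (Idt C A) = Idt D (fob F A)"
    and far_Comp: "f \<in> Hom C A B \<Longrightarrow> g \<in> Hom C B E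
      \<Longrightarrow> far F (g \<cdot>\<^bsub>C\<^esub> f) = far F g \<cdot>\<^bsub>D\<^esub> far F f"

definition id_functr :: "('o, 'a, 'o, 'a) functr" where
  "id_functr = \<lparr> fob = id, far = id \<rparr>"

definition comp_functr ::
    "('p, 'b, 'q, 'c) functr \<Rightarrow> ('o, 'a, 'p, 'b) functr \<Rightarrow> ('o, 'a, 'q, 'c) functr"
    (infixr "\<circ>\<^sub>F" 55) where
  "G \<circ>\<^sub>F F = \<lparr> fob = fob G \<circ> fob F, far = far G \<circ> far F \<rparr>"

definition prod_functr ::
    "('o, 'a, 'p, 'b) functr \<Rightarrow> ('o', 'a', 'p', 'b') functr
     \<Rightarrow> ('o \<times> 'o', 'a \<times> 'a', 'p \<times> 'p', 'b \<times> 'b') functr"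
    (infixr "\<otimes>\<^sub>F" 60) where
  "F \<otimes>\<^sub>F G = \<lparr> fob = map_prod (fob F) (fob G), far = map_prod (far F) (far G) \<rparr>"

locale nat_trans =
  fixes C :: "('o, 'a) cat" and D :: "('p, 'b) cat"
    and F G :: "('o, 'a, 'p, 'b) functr" and \<tau> :: "'o \<Rightarrow> 'b"
  assumes component: "A \<in> Ob C \<Longrightarrow> \<tau> A \<in> Hom D (fob F A) (fob G A)"
    and naturality: "f \<in> Hom C A B \<Longrightarrow> \<tau> B \<cdot>\<^bsub>D\<^esub> far F f = far G f \<cdot>\<^bsub>D\<^esub> \<tau> A"

locale nat_iso = nat_trans C D F G \<tau>
  for C :: "('o, 'a) cat" and D :: "('p, 'b) cat"
    and F G :: "('o, 'a, 'p, 'b) functr" and \<tau> :: "'o \<Rightarrow> 'b" +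
  assumes invertible: "A \<in> Ob C \<Longrightarrow> is_iso D (\<tau> A)"

text \<open>\<open>F : C \<rightarrow> D\<close> is left adjoint to \<open>G : D \<rightarrow> C\<close>, with unit \<open>\<eta>\<close> and counit \<open>\<epsilon>\<close>.\<close>

locale adjunction =
  fixes C :: "('o, 'a) cat" and D :: "('p, 'b) cat"
    and F :: "('o, 'a, 'p, 'b) functr" and G :: "('p, 'b, 'o, 'a) functr"
    and \<eta> :: "'o \<Rightarrow> 'a" and \<epsilon> :: "'p \<Rightarrow> 'b"
  assumes left_functor: "is_functor C D F"
    and right_functor: "is_functor D C G"
    and unit: "nat_trans C C id_functr (G \<circ>\<^sub>F F) \<eta>"
    and counit: "nat_trans D D (F \<circ>\<^sub>F G) id_functr \<epsilon>"
    and triangle_left: "A \<in> Ob C \<Longrightarrow> \<epsilon> (fob F A) \<cdot>\<^bsub>D\<^esub> far F (\<eta> A) = Idt D (fob F A)"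
    and triangle_right: "B \<in> Ob D \<Longrightarrow> far G (\<epsilon> B) \<cdot>\<^bsub>C\<^esub> \<eta> (fob G B) = Idt C (fob G B)"


section \<open>Binary products, smooth morphisms and closed immersions\<close>

record ('s, 'a) prod_data =
  Prd :: "'s \<Rightarrow> 's \<Rightarrow> 's"
  pr1 :: "'s \<Rightarrow> 's \<Rightarrow> 'a"
  pr2 :: "'s \<Rightarrow> 's \<Rightarrow> 'a"

locale binary_products =
  fixes S :: "('s, 'a) cat" (structure) and P :: "('s, 'a) prod_data"
  assumes Prd_Ob: "A \<in> Ob S \<Longrightarrow> B \<in> Ob S \<Longrightarrow> Prd P A B \<in> Ob S"
    and pr1_Hom: "A \<in> Ob S \<Longrightarrow> B \<in> Ob S \<Longrightarrow> pr1 P A B \<in> Hom S (Prd P A B) A"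
    and pr2_Hom: "A \<in> Ob S \<Longrightarrow> B \<in> Ob S \<Longrightarrow> pr2 P A B \<in> Hom S (Prd P A B) B"
    and Prd_universal: "A \<in> Ob S \<Longrightarrow> B \<in> Ob S \<Longrightarrow> u \<in> Hom S X A \<Longrightarrow> v \<in> Hom S X B
      \<Longrightarrow> \<exists>!w. w \<in> Hom S X (Prd P A B) \<and> pr1 P A B \<cdot> w = u \<and> pr2 P A B \<cdot> w = v"

definition prd_ar :: "('s, 'a) cat \<Rightarrow> ('s, 'a) prod_data \<Rightarrow> 'a \<Rightarrow> 'a \<Rightarrow> 'a" where
  "prd_ar S P f1 f2 =
    (THE h. h \<in> Hom S (Prd P (Dom S f1) (Dom S f2)) (Prd P (Cod S f1) (Cod S f2)) \<and>
       pr1 P (Cod S f1) (Cod S f2) \<cdot>\<^bsub>S\<^esub> h = f1 \<cdot>\<^bsub>S\<^esub> pr1 P (Dom S f1) (Dom S f2) \<and>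
       pr2 P (Cod S f1) (Cod S f2) \<cdot>\<^bsub>S\<^esub> h = f2 \<cdot>\<^bsub>S\<^esub> pr2 P (Dom S f1) (Dom S f2))"

text \<open>\<open>comm_square S p h z q\<close> says that \<open>p h = z q\<close>, where \<open>h : Q \<rightarrow> P\<close>, \<open>q : Q \<rightarrow> Z\<close>,
  \<open>p : P \<rightarrow> X\<close> and \<open>z : Z \<rightarrow> X\<close>. Such a square is Cartesian if \<open>Q\<close> is the fibered product
  of \<open>p\<close> and \<open>z\<close>; then \<open>q\<close> is the base change of \<open>p\<close>, and \<open>h\<close> that of \<open>z\<close>.\<close>

definition comm_square :: "('s, 'a) cat \<Rightarrow> 'a \<Rightarrow> 'a \<Rightarrow> 'a \<Rightarrow> 'a \<Rightarrow> bool" where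
  "comm_square S p h z q \<longleftrightarrow>
     p \<in> Ar S \<and> h \<in> Ar S \<and> z \<in> Ar S \<and> q \<in> Ar S \<and>
     Dom S h = Dom S q \<and> Cod S h = Dom S p \<and> Cod S q = Dom S z \<and> Cod S p = Cod S z \<and>
     p \<cdot>\<^bsub>S\<^esub> h = z \<cdot>\<^bsub>S\<^esub> q"

definition cartesian_square :: "('s, 'a) cat \<Rightarrow> 'a \<Rightarrow> 'a \<Rightarrow> 'a \<Rightarrow> 'a \<Rightarrow> bool" where
  "cartesian_square S p h z q \<longleftrightarrow> comm_square S p h z q \<and>
     (\<forall>X u v. u \<in> Hom S X (Dom S p) \<longrightarrow> v \<in> Hom S X (Dom S z) \<longrightarrow> p \<cdot>\<^bsub>S\<^esub> u = z \<cdot>\<^bsub>S\<^esub> v \<longrightarrow>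
        (\<exists>!w. w \<in> Hom S X (Dom S q) \<and> h \<cdot>\<^bsub>S\<^esub> w = u \<and> q \<cdot>\<^bsub>S\<^esub> w = v))"

text \<open>A subcategory with the same objects is given by its set of morphisms.\<close>

locale wide_subcategory =
  fixes S :: "('s, 'a) cat" (structure) and M :: "'a set"
  assumes sub_Ar: "M \<subseteq> Ar S"
    and sub_Idt: "A \<in> Ob S \<Longrightarrow> Idt S A \<in> M"
    and sub_Comp: "f \<in> M \<Longrightarrow> g \<in> M \<Longrightarrow> Cod S f = Dom S g \<Longrightarrow> g \<cdot> f \<in> M"

locale smooth_closed = category S
  for S :: "('s, 'a) cat" (structure) +
  fixes Sm Cl :: "'a set"
  assumes Sm_sub: "wide_subcategory S Sm"
    and Cl_sub: "wide_subcategory S Cl"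
    and iso_Sm: "is_iso S f \<Longrightarrow> f \<in> Sm"
    and iso_Cl: "is_iso S f \<Longrightarrow> f \<in> Cl"
    and Sm_fibered_product: "p \<in> Sm \<Longrightarrow> f \<in> Ar S \<Longrightarrow> Cod S f = Cod S p
      \<Longrightarrow> \<exists>f' p'. cartesian_square S p f' f p'"
    and Sm_base_change: "p \<in> Sm \<Longrightarrow> cartesian_square S p f' f p' \<Longrightarrow> p' \<in> Sm"
    and Cl_base_change: "p \<in> Sm \<Longrightarrow> z \<in> Cl \<Longrightarrow> cartesian_square S p z' z p' \<Longrightarrow> z' \<in> Cl"
    and Cl_cancel: "z \<in> Ar S \<Longrightarrow> g \<in> Ar S \<Longrightarrow> Cod S z = Dom S g \<Longrightarrow> g \<cdot> z \<in> Cl \<Longrightarrow> z \<in> Cl"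
    and factorization: "f \<in> Ar S
      \<Longrightarrow> \<exists>p t. p \<in> Sm \<and> t \<in> Cl \<and> Cod S t = Dom S p \<and> f = p \<cdot> t"


section \<open>Fibered categories\<close>

text \<open>\<open>Conn H f g\<close> is the connection isomorphism \<open>(g f)\<^sup>* A \<rightarrow> f\<^sup>* g\<^sup>* A\<close>.\<close>

record ('s, 'a, 'x, 'y) fib_cat =
  Fib :: "'s \<Rightarrow> ('x, 'y) cat"
  Pull :: "'a \<Rightarrow> ('x, 'y, 'x, 'y) functr"
  Conn :: "'a \<Rightarrow> 'a \<Rightarrow> 'x \<Rightarrow> 'y"

locale fibered_category =
  fixes S :: "('s, 'a) cat" (structure) and H :: "('s, 'a, 'x, 'y) fib_cat"
  assumes Fib_category: "X \<in> Ob S \<Longrightarrow> category (Fib H X)"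
    and Pull_functor: "f \<in> Hom S T X \<Longrightarrow> is_functor (Fib H X) (Fib H T) (Pull H f)"
    and Conn_iso: "f \<in> Hom S T X \<Longrightarrow> g \<in> Hom S X V \<Longrightarrow>
      nat_iso (Fib H V) (Fib H T) (Pull H (g \<cdot> f)) (Pull H f \<circ>\<^sub>F Pull H g) (Conn H f g)"
    and Pull_Idt_Ob: "X \<in> Ob S \<Longrightarrow> A \<in> Ob (Fib H X) \<Longrightarrow> fob (Pull H (Idt S X)) A = A"
    and Pull_Idt_Ar: "X \<in> Ob S \<Longrightarrow> \<phi> \<in> Ar (Fib H X) \<Longrightarrow> far (Pull H (Idt S X)) \<phi> = \<phi>"
    and Conn_cocycle: "f \<in> Hom S T X \<Longrightarrow> g \<in> Hom S X V \<Longrightarrow> h \<in> Hom S V W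
      \<Longrightarrow> A \<in> Ob (Fib H W) \<Longrightarrow>
      far (Pull H f) (Conn H g h A) \<cdot>\<^bsub>Fib H T\<^esub> Conn H f (h \<cdot> g) A
        = Conn H f g (fob (Pull H h) A) \<cdot>\<^bsub>Fib H T\<^esub> Conn H (g \<cdot> f) h A"


section \<open>External tensor structures and skeletons\<close>

type_synonym ('s, 'x, 'y) ext_prod = "'s \<Rightarrow> 's \<Rightarrow> ('x \<times> 'x, 'y \<times> 'y, 'x, 'y) functr"

type_synonym ('a, 'x, 'y) ext_mon = "'a \<Rightarrow> 'a \<Rightarrow> 'x \<times> 'x \<Rightarrow> 'y"

text \<open>Given \<open>f\<^sub>i : T\<^sub>i \<rightarrow> S\<^sub>i\<close> and \<open>g\<^sub>i : S\<^sub>i \<rightarrow> V\<^sub>i\<close>, the following arrow is the composite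
  \<open>f\<^sub>1\<^sup>* g\<^sub>1\<^sup>* A\<^sub>1 \<boxtimes> f\<^sub>2\<^sup>* g\<^sub>2\<^sup>* A\<^sub>2 \<rightarrow> (f\<^sub>1 \<times> f\<^sub>2)\<^sup>* (g\<^sub>1\<^sup>* A\<^sub>1 \<boxtimes> g\<^sub>2\<^sup>* A\<^sub>2) \<rightarrow> (f\<^sub>1 \<times> f\<^sub>2)\<^sup>* (g\<^sub>1 \<times> g\<^sub>2)\<^sup>* (A\<^sub>1 \<boxtimes> A\<^sub>2)\<close>
  of \<open>m\<close> at \<open>(f\<^sub>1, f\<^sub>2)\<close> and \<open>n\<close> at \<open>(g\<^sub>1, g\<^sub>2)\<close>, transported along connection isomorphisms to
  an arrow \<open>(g\<^sub>1 f\<^sub>1)\<^sup>* A\<^sub>1 \<boxtimes> (g\<^sub>2 f\<^sub>2)\<^sup>* A\<^sub>2 \<rightarrow> (g\<^sub>1 f\<^sub>1 \<times> g\<^sub>2 f\<^sub>2)\<^sup>* (A\<^sub>1 \<boxtimes> A\<^sub>2)\<close>. Two such composites with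
  the same \<open>g\<^sub>i f\<^sub>i\<close> coincide modulo connection isomorphisms iff these arrows are equal.\<close>

definition two_step ::
    "('s, 'a) cat \<Rightarrow> ('s, 'a) prod_data \<Rightarrow> ('s, 'a, 'x, 'y) fib_cat \<Rightarrow> ('s, 'x, 'y) ext_prod
     \<Rightarrow> ('a, 'x, 'y) ext_mon \<Rightarrow> ('a, 'x, 'y) ext_mon
     \<Rightarrow> 'a \<Rightarrow> 'a \<Rightarrow> 'a \<Rightarrow> 'a \<Rightarrow> 'x \<Rightarrow> 'x \<Rightarrow> 'y" where
  "two_step S P H E m n f1 f2 g1 g2 A1 A2 =
    (let T1 = Dom S f1; T2 = Dom S f2; V1 = Cod S g1; V2 = Cod S g2;
         f = prd_ar S P f1 f2; g = prd_ar S P g1 g2;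
         D = Fib H (Prd P T1 T2)
     in inv_ar D (Conn H f g (fob (E V1 V2) (A1, A2)))
        \<cdot>\<^bsub>D\<^esub> far (Pull H f) (n g1 g2 (A1, A2))
        \<cdot>\<^bsub>D\<^esub> m f1 f2 (fob (Pull H g1) A1, fob (Pull H g2) A2)
        \<cdot>\<^bsub>D\<^esub> far (E T1 T2) (Conn H f1 g1 A1, Conn H f2 g2 A2))"

text \<open>An external tensor structure on the restriction of \<open>H\<close> to the wide subcategory with
  morphisms \<open>M\<close>; the choice \<open>M = Ar S\<close> gives those on \<open>H\<close> itself. Since \<open>m\<close> is represented by a
  total function, its values outside the relevant domain are normalized, so that equality of
  functions is equality of structures.\<close>

locale ext_tensor_structure =
  fixes S :: "('s, 'a) cat" (structure) and P :: "('s, 'a) prod_data"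
    and H :: "('s, 'a, 'x, 'y) fib_cat" and M :: "'a set"
    and E :: "('s, 'x, 'y) ext_prod" and m :: "('a, 'x, 'y) ext_mon"
  assumes ext_functor: "X1 \<in> Ob S \<Longrightarrow> X2 \<in> Ob S \<Longrightarrow>
      is_functor (prod_cat (Fib H X1) (Fib H X2)) (Fib H (Prd P X1 X2)) (E X1 X2)"
    and mon_iso: "f1 \<in> M \<Longrightarrow> f2 \<in> M \<Longrightarrow> f1 \<in> Hom S T1 X1 \<Longrightarrow> f2 \<in> Hom S T2 X2 \<Longrightarrow>
      nat_iso (prod_cat (Fib H X1) (Fib H X2)) (Fib H (Prd P T1 T2))
        (E T1 T2 \<circ>\<^sub>F (Pull H f1 \<otimes>\<^sub>F Pull H f2)) (Pull H (prd_ar S P f1 f2) \<circ>\<^sub>F E X1 X2) (m f1 f2)"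
    and mon_comp: "f1 \<in> M \<Longrightarrow> f2 \<in> M \<Longrightarrow> g1 \<in> M \<Longrightarrow> g2 \<in> M
      \<Longrightarrow> Cod S f1 = Dom S g1 \<Longrightarrow> Cod S f2 = Dom S g2
      \<Longrightarrow> A1 \<in> Ob (Fib H (Cod S g1)) \<Longrightarrow> A2 \<in> Ob (Fib H (Cod S g2)) \<Longrightarrow>
      m (g1 \<cdot> f1) (g2 \<cdot> f2) (A1, A2) = two_step S P H E m m f1 f2 g1 g2 A1 A2"
    and mon_extensional:
      "\<not> (f1 \<in> M \<and> f2 \<in> M \<and> A1 \<in> Ob (Fib H (Cod S f1)) \<and> A2 \<in> Ob (Fib H (Cod S f2)))
        \<Longrightarrow> m f1 f2 (A1, A2) = undefined"

definition mon_restrict :: "('a, 'x, 'y) ext_mon \<Rightarrow> 'a set \<Rightarrow> ('a, 'x, 'y) ext_mon" where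
  "mon_restrict m M = (\<lambda>f1 f2 A. if f1 \<in> M \<and> f2 \<in> M then m f1 f2 A else undefined)"

locale ext_tensor_skeleton =
  fixes S :: "('s, 'a) cat" (structure) and P :: "('s, 'a) prod_data"
    and H :: "('s, 'a, 'x, 'y) fib_cat" and Sm Cl :: "'a set"
    and E :: "('s, 'x, 'y) ext_prod" and msm mcl :: "('a, 'x, 'y) ext_mon"
  assumes smooth_structure: "ext_tensor_structure S P H Sm E msm"
    and closed_structure: "ext_tensor_structure S P H Cl E mcl"
    and exchange: "comm_square S p1 h1 z1 q1 \<Longrightarrow> comm_square S p2 h2 z2 q2
      \<Longrightarrow> p1 \<in> Sm \<Longrightarrow> q1 \<in> Sm \<Longrightarrow> z1 \<in> Cl \<Longrightarrow> h1 \<in> Cl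
      \<Longrightarrow> p2 \<in> Sm \<Longrightarrow> q2 \<in> Sm \<Longrightarrow> z2 \<in> Cl \<Longrightarrow> h2 \<in> Cl
      \<Longrightarrow> A1 \<in> Ob (Fib H (Cod S p1)) \<Longrightarrow> A2 \<in> Ob (Fib H (Cod S p2)) \<Longrightarrow>
      two_step S P H E msm mcl q1 q2 z1 z2 A1 A2 = two_step S P H E mcl msm h1 h2 p1 p2 A1 A2"


section \<open>Smooth-adjointability\<close>

definition smooth_adjointable :: "('s, 'a) cat \<Rightarrow> 'a set \<Rightarrow> ('s, 'a, 'x, 'y) fib_cat \<Rightarrow> bool" where
  "smooth_adjointable S Sm H \<longleftrightarrow>
     (\<forall>p \<in> Sm. \<exists>F \<eta> \<epsilon>. adjunction (Fib H (Dom S p)) (Fib H (Cod S p)) F (Pull H p) \<eta> \<epsilon>)"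

text \<open>The notation \<open>p\<^sub>#\<close> refers to a choice of left adjoints, with units and counits.\<close>

record ('a, 'x, 'y) adj_choice =
  Sharp :: "'a \<Rightarrow> ('x, 'y, 'x, 'y) functr"
  Unit :: "'a \<Rightarrow> 'x \<Rightarrow> 'y"
  Counit :: "'a \<Rightarrow> 'x \<Rightarrow> 'y"

definition left_adjoints ::
    "('s, 'a) cat \<Rightarrow> 'a set \<Rightarrow> ('s, 'a, 'x, 'y) fib_cat \<Rightarrow> ('a, 'x, 'y) adj_choice \<Rightarrow> bool" where
  "left_adjoints S Sm H L \<longleftrightarrow>
     (\<forall>p \<in> Sm. adjunction (Fib H (Dom S p)) (Fib H (Cod S p))
        (Sharp L p) (Pull H p) (Unit L p) (Counit L p))"

text \<open>The composite
  \<open>(p\<^sub>1 \<times> p\<^sub>2)\<^sub># (A\<^sub>1 \<boxtimes> A\<^sub>2) \<rightarrow> (p\<^sub>1 \<times> p\<^sub>2)\<^sub># (p\<^sub>1\<^sup>* p\<^sub>1\<^sub># A\<^sub>1 \<boxtimes> p\<^sub>2\<^sup>* p\<^sub>2\<^sub># A\<^sub>2)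
    \<rightarrow> (p\<^sub>1 \<times> p\<^sub>2)\<^sub># (p\<^sub>1 \<times> p\<^sub>2)\<^sup>* (p\<^sub>1\<^sub># A\<^sub>1 \<boxtimes> p\<^sub>2\<^sub># A\<^sub>2) \<rightarrow> p\<^sub>1\<^sub># A\<^sub>1 \<boxtimes> p\<^sub>2\<^sub># A\<^sub>2\<close>.\<close>

definition sharp_comparison ::
    "('s, 'a) cat \<Rightarrow> ('s, 'a) prod_data \<Rightarrow> ('s, 'a, 'x, 'y) fib_cat \<Rightarrow> ('a, 'x, 'y) adj_choice
     \<Rightarrow> ('s, 'x, 'y) ext_prod \<Rightarrow> ('a, 'x, 'y) ext_mon \<Rightarrow> 'a \<Rightarrow> 'a \<Rightarrow> 'x \<Rightarrow> 'x \<Rightarrow> 'y" where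
  "sharp_comparison S P H L E m p1 p2 A1 A2 =
    (let p = prd_ar S P p1 p2;
         B1 = fob (Sharp L p1) A1; B2 = fob (Sharp L p2) A2;
         D = Fib H (Prd P (Cod S p1) (Cod S p2))
     in Counit L p (fob (E (Cod S p1) (Cod S p2)) (B1, B2))
        \<cdot>\<^bsub>D\<^esub> far (Sharp L p) (m p1 p2 (B1, B2))
        \<cdot>\<^bsub>D\<^esub> far (Sharp L p) (far (E (Dom S p1) (Dom S p2)) (Unit L p1 A1, Unit L p2 A2)))"

definition smooth_adjointable_tensor ::
    "('s, 'a) cat \<Rightarrow> ('s, 'a) prod_data \<Rightarrow> 'a set \<Rightarrow> ('s, 'a, 'x, 'y) fib_cat
     \<Rightarrow> ('a, 'x, 'y) adj_choice \<Rightarrow> ('s, 'x, 'y) ext_prod \<Rightarrow> ('a, 'x, 'y) ext_mon \<Rightarrow> bool" where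
  "smooth_adjointable_tensor S P Sm H L E m \<longleftrightarrow>
    (\<forall>p1 \<in> Sm. \<forall>p2 \<in> Sm. \<forall>A1 \<in> Ob (Fib H (Dom S p1)). \<forall>A2 \<in> Ob (Fib H (Dom S p2)).
       is_iso (Fib H (Prd P (Cod S p1) (Cod S p2))) (sharp_comparison S P H L E m p1 p2 A1 A2))"

definition smooth_adjointable_skeleton ::
    "('s, 'a) cat \<Rightarrow> ('s, 'a) prod_data \<Rightarrow> 'a set \<Rightarrow> ('s, 'a, 'x, 'y) fib_cat
     \<Rightarrow> ('a, 'x, 'y) adj_choice \<Rightarrow> ('s, 'x, 'y) ext_prod
     \<Rightarrow> ('a, 'x, 'y) ext_mon \<Rightarrow> ('a, 'x, 'y) ext_mon \<Rightarrow> bool" where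
  "smooth_adjointable_skeleton S P Sm H L E msm mcl \<longleftrightarrow> smooth_adjointable_tensor S P Sm H L E msm"

end

theory Submission
  imports Defs
begin

text \<open>
  An external tensor structure lives over pairs of arrows and relates two fibered categories over
  \<open>S \<times> S\<close>: one has fibres \<open>H(X\<^sub>1) \<times> H(X\<^sub>2)\<close>, the other has fibres \<open>H(X\<^sub>1 \<times> X\<^sub>2)\<close>, and \<open>E = \<boxtimes>\<close> is a
  functor from the one to the other over each object. A tensor structure on a class of arrows is a
  compatible choice of invertible cells \<open>E f\<^sup>* \<cong> f\<^sup>* E\<close>, so everything reduces to a statement
  about two fibered categories over one base \<open>C\<close> in which every arrow factors as a closed
  immersion \<open>t\<close> followed by a smooth arrow \<open>p\<close>. A cell \<open>\<alpha>\<close> over \<open>f\<close> and a cell \<open>\<beta>\<close> over \<open>g\<close> paste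
  to a cell \<open>\<alpha> * \<beta>\<close> over \<open>g f\<close>. Pasting is associative (\<open>paste_assoc\<close>), and the cells over
  identities in a compatible family are left units (\<open>paste_idempotent_left\<close>).

  In one direction, both composites in the exchange condition are pastings over the two ways
  around a commutative square, hence equal to the cell over its diagonal. Conversely the cell over
  \<open>p t\<close> has to be \<open>mcl\<^sub>t * msm\<^sub>p\<close>, which gives uniqueness. This cell is independent of the
  factorization (\<open>paste_factorization_independent\<close>). For two factorizations of the same arrow, the
  common source maps to the fibered product of the two intermediate objects by some \<open>s\<close>, which is
  a closed immersion by the cancellation property, and whose composites with the smooth
  projections are the two given closed immersions. It remains to pass from \<open>(a s, p)\<close> to \<open>(s, p
  a)\<close>. The exchange condition for the square \<open>a s = (a s) id\<close> and the unit law give \<open>mcl\<^sub>s * msm\<^sub>a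
  = mcl\<^bsub>a s\<^esub>\<close>, and then \<open>mcl\<^bsub>a s\<^esub> * msm\<^sub>p = mcl\<^sub>s * msm\<^sub>a * msm\<^sub>p = mcl\<^sub>s * msm\<^bsub>p a\<^esub>\<close>.

  For compatibility with composition (\<open>extension_paste\<close>), take \<open>f = p t\<close> and \<open>g = p' t'\<close> and
  factor the middle part as \<open>t' p = q u\<close>. The exchange condition for this square turns \<open>mcl\<^sub>u *
  msm\<^sub>q\<close> into \<open>msm\<^sub>p * mcl\<^bsub>t'\<^esub>\<close>, and \<open>g f = (p' q) (u t)\<close> is again a factorization, so \<open>mcl\<^bsub>u t\<^esub> *
  msm\<^bsub>p' q\<^esub> = mcl\<^sub>t * mcl\<^sub>u * msm\<^sub>q * msm\<^bsub>p'\<^esub> = (mcl\<^sub>t * msm\<^sub>p) * (mcl\<^bsub>t'\<^esub> * msm\<^bsub>p'\<^esub>)\<close>.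

  The factorization \<open>p = p id\<close> and the unit law show that the new family extends \<open>msm\<close>. It extends
  \<open>mcl\<close> by \<open>z = id z\<close> and the identity \<open>mcl\<^sub>s * msm\<^sub>a = mcl\<^bsub>a s\<^esub>\<close> for \<open>s = z\<close> and \<open>a = id\<close>.

  Smooth-adjointability evaluates \<open>m\<close> only at pairs of smooth arrows, where it agrees with its
  restriction.
\<close>

section \<open>Invertible arrows\<close>

context category
begin

lemma HomD: "f \<in> Hom C A B \<Longrightarrow> f \<in> Ar C \<and> Dom C f = A \<and> Cod C f = B"
  by (simp add: Hom_def)

lemma Hom_Ob: "f \<in> Hom C A B \<Longrightarrow> A \<in> Ob C \<and> B \<in> Ob C"
  using Dom_Ob Cod_Ob by (auto simp: Hom_def)

lemma Ar_Hom: "f \<in> Ar C \<Longrightarrow> f \<in> Hom C (Dom C f) (Cod C f)"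
  by (simp add: Hom_def)

lemma inverse_arrows_unique:
  assumes "inverse_arrows C f g" "inverse_arrows C f h"
  shows "g = h"
proof -
  let ?A = "Dom C f" and ?B = "Cod C f"
  have hom: "f \<in> Hom C ?A ?B" "g \<in> Hom C ?B ?A" "h \<in> Hom C ?B ?A"
    using assms by (auto simp: inverse_arrows_def Hom_def)
  have "g = g \<cdot> (f \<cdot> h)"
    using assms(2) Comp_Idt[OF hom(2)] by (simp add: inverse_arrows_def)
  also have "\<dots> = (g \<cdot> f) \<cdot> h" using Comp_assoc[OF hom(3,1,2)] by simp
  also have "\<dots> = h" using assms(1) Idt_Comp[OF hom(3)] by (simp add: inverse_arrows_def)
  finally show ?thesis .
qed

lemma inverse_arrows_inv_ar:
  assumes "is_iso C f"
  shows "inverse_arrows C f (inv_ar C f)"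
proof -
  obtain g where "inverse_arrows C f g" using assms by (auto simp: is_iso_def)
  then show ?thesis
    unfolding inv_ar_def by (rule theI) (auto intro: inverse_arrows_unique \<open>inverse_arrows C f g\<close>)
qed

lemma iso_inverse:
  assumes "is_iso C f" "f \<in> Hom C A B"
  shows "inv_ar C f \<in> Hom C B A" "inv_ar C f \<cdot> f = Idt C A" "f \<cdot> inv_ar C f = Idt C B"
    "is_iso C (inv_ar C f)"
proof -
  have inv: "inverse_arrows C f (inv_ar C f)" by (rule inverse_arrows_inv_ar) fact
  with assms(2) show hom: "inv_ar C f \<in> Hom C B A" and "inv_ar C f \<cdot> f = Idt C A"
    and "f \<cdot> inv_ar C f = Idt C B"
    by (auto simp: inverse_arrows_def Hom_def)
  with assms(2) have "inverse_arrows C (inv_ar C f) f"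
    by (auto simp: inverse_arrows_def Hom_def)
  then show "is_iso C (inv_ar C f)" by (auto simp: is_iso_def)
qed

lemma iso_cancel_left:
  assumes "is_iso C k" "k \<in> Hom C B D" "x \<in> Hom C A B" "y \<in> Hom C A B" "k \<cdot> x = k \<cdot> y"
  shows "x = y"
proof -
  note inv = iso_inverse[OF assms(1,2)]
  have "x = (inv_ar C k \<cdot> k) \<cdot> x" using inv(2) Idt_Comp[OF assms(3)] by simp
  also have "\<dots> = (inv_ar C k \<cdot> k) \<cdot> y"
    using Comp_assoc[OF assms(3,2) inv(1)] Comp_assoc[OF assms(4,2) inv(1)] assms(5) by simp
  also have "\<dots> = y" using inv(2) Idt_Comp[OF assms(4)] by simp
  finally show ?thesis .
qed

lemma iso_cancel_right:
  assumes "is_iso C k" "k \<in> Hom C A B" "x \<in> Hom C B D" "y \<in> Hom C B D" "x \<cdot> k = y \<cdot> k"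
  shows "x = y"
proof -
  note inv = iso_inverse[OF assms(1,2)]
  have "x = x \<cdot> (k \<cdot> inv_ar C k)" using inv(3) Comp_Idt[OF assms(3)] by simp
  also have "\<dots> = y \<cdot> (k \<cdot> inv_ar C k)"
    using Comp_assoc[OF inv(1) assms(2,3)] Comp_assoc[OF inv(1) assms(2,4)] assms(5) by simp
  also have "\<dots> = y" using inv(3) Comp_Idt[OF assms(4)] by simp
  finally show ?thesis .
qed

lemma iso_comp:
  assumes "is_iso C f" "is_iso C g" "f \<in> Hom C A B" "g \<in> Hom C B D"
  shows "is_iso C (g \<cdot> f)"
proof -
  let ?f = "inv_ar C f" and ?g = "inv_ar C g"
  note f = iso_inverse[OF assms(1,3)] and g = iso_inverse[OF assms(2,4)]
  have gf: "g \<cdot> f \<in> Hom C A D" by (rule Comp_Hom[OF assms(3,4)])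
  have fg: "?f \<cdot> ?g \<in> Hom C D A" by (rule Comp_Hom[OF g(1) f(1)])
  have "(?f \<cdot> ?g) \<cdot> (g \<cdot> f) = ?f \<cdot> ((?g \<cdot> g) \<cdot> f)"
    using Comp_assoc[OF gf g(1) f(1)] Comp_assoc[OF assms(3,4) g(1)] by simp
  then have 1: "(?f \<cdot> ?g) \<cdot> (g \<cdot> f) = Idt C A" using g(2) f(2) Idt_Comp[OF assms(3)] by simp
  have "(g \<cdot> f) \<cdot> (?f \<cdot> ?g) = g \<cdot> ((f \<cdot> ?f) \<cdot> ?g)"
    using Comp_assoc[OF fg assms(3,4)] Comp_assoc[OF g(1) f(1) assms(3)] by simp
  then have 2: "(g \<cdot> f) \<cdot> (?f \<cdot> ?g) = Idt C D" using g(3) f(3) Idt_Comp[OF g(1)] by simp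
  have "inverse_arrows C (g \<cdot> f) (?f \<cdot> ?g)"
    using 1 2 gf fg by (simp add: inverse_arrows_def Hom_def)
  then show ?thesis by (auto simp: is_iso_def)
qed

end

lemma (in is_functor) far_iso:
  assumes "category C" "is_iso C f"
  shows "is_iso D (far F f)"
proof -
  interpret category C by fact
  obtain g where g: "inverse_arrows C f g" using assms(2) by (auto simp: is_iso_def)
  let ?A = "Dom C f" and ?B = "Cod C f"
  have hom: "f \<in> Hom C ?A ?B" "g \<in> Hom C ?B ?A" using g by (auto simp: inverse_arrows_def Hom_def)
  then have "?A \<in> Ob C" "?B \<in> Ob C" using Hom_Ob by auto
  then have "inverse_arrows D (far F f) (far F g)"
    using far_Hom[OF hom(1)] far_Hom[OF hom(2)] far_Comp[OF hom] far_Comp[OF hom(2,1)] g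
    by (auto simp: inverse_arrows_def Hom_def far_Idt)
  then show ?thesis by (auto simp: is_iso_def)
qed

section \<open>Fibered categories on objects and arrows\<close>

context fibered_category
begin

lemma Pull_Ob: "f \<in> Hom S T X \<Longrightarrow> A \<in> Ob (Fib H X) \<Longrightarrow> fob (Pull H f) A \<in> Ob (Fib H T)"
  using Pull_functor is_functor.fob_Ob by metis

lemma ConnD:
  assumes f: "f \<in> Hom S T X" and g: "g \<in> Hom S X V"
  shows Conn_Hom: "A \<in> Ob (Fib H V) \<Longrightarrow> Conn H f g A
      \<in> Hom (Fib H T) (fob (Pull H (g \<cdot> f)) A) (fob (Pull H f) (fob (Pull H g) A))"
    and Conn_natural: "\<phi> \<in> Hom (Fib H V) A B \<Longrightarrow>
      Conn H f g B \<cdot>\<^bsub>Fib H T\<^esub> far (Pull H (g \<cdot> f)) \<phi>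
        = far (Pull H f) (far (Pull H g) \<phi>) \<cdot>\<^bsub>Fib H T\<^esub> Conn H f g A"
    and Conn_is_iso: "A \<in> Ob (Fib H V) \<Longrightarrow> is_iso (Fib H T) (Conn H f g A)"
proof -
  interpret nat_iso "Fib H V" "Fib H T" "Pull H (g \<cdot> f)" "Pull H f \<circ>\<^sub>F Pull H g" "Conn H f g"
    by (rule Conn_iso[OF f g])
  show "A \<in> Ob (Fib H V) \<Longrightarrow> Conn H f g A
      \<in> Hom (Fib H T) (fob (Pull H (g \<cdot> f)) A) (fob (Pull H f) (fob (Pull H g) A))"
    using component[of A] by (simp add: comp_functr_def)
  show "\<phi> \<in> Hom (Fib H V) A B \<Longrightarrow> Conn H f g B \<cdot>\<^bsub>Fib H T\<^esub> far (Pull H (g \<cdot> f)) \<phi>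
        = far (Pull H f) (far (Pull H g) \<phi>) \<cdot>\<^bsub>Fib H T\<^esub> Conn H f g A"
    using naturality[of \<phi> A B] by (simp add: comp_functr_def)
  show "A \<in> Ob (Fib H V) \<Longrightarrow> is_iso (Fib H T) (Conn H f g A)" by (rule invertible)
qed

end

section \<open>Pasting comparison cells between two fibered categories\<close>

locale fibrewise_functors = category C + H: fibered_category C H + K: fibered_category C K
  for C :: "('s, 'a) cat" (structure)
    and H :: "('s, 'a, 'x, 'y) fib_cat" and K :: "('s, 'a, 'u, 'v) fib_cat" +
  fixes E :: "'s \<Rightarrow> ('x, 'y, 'u, 'v) functr"
  assumes E_functor: "X \<in> Ob C \<Longrightarrow> is_functor (Fib H X) (Fib K X) (E X)"
begin

text \<open>A cell over \<open>f : T \<rightarrow> X\<close> is a natural isomorphism \<open>E\<^sub>T f\<^sup>* \<cong> f\<^sup>* E\<^sub>X\<close>. Fixing its value off the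
  objects of \<open>H(X)\<close> makes equality of functions the same as equality of cells, so that the laws
  below can be stated and rewritten without quantifying over objects.\<close>

definition cell :: "'a \<Rightarrow> ('x \<Rightarrow> 'v) \<Rightarrow> bool" where
  "cell f \<alpha> \<longleftrightarrow>
     nat_iso (Fib H (Cod C f)) (Fib K (Dom C f))
       (E (Dom C f) \<circ>\<^sub>F Pull H f) (Pull K f \<circ>\<^sub>F E (Cod C f)) \<alpha> \<and>
     (\<forall>A. A \<notin> Ob (Fib H (Cod C f)) \<longrightarrow> \<alpha> A = undefined)"

text \<open>The composite \<open>E\<^sub>T (g f)\<^sup>* \<rightarrow> E\<^sub>T f\<^sup>* g\<^sup>* \<rightarrow> f\<^sup>* E\<^sub>X g\<^sup>* \<rightarrow> f\<^sup>* g\<^sup>* E\<^sub>V \<rightarrow> (g f)\<^sup>* E\<^sub>V\<close>; over pairs of arrows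
  it becomes \<open>two_step\<close>.\<close>

definition paste :: "'a \<Rightarrow> 'a \<Rightarrow> ('x \<Rightarrow> 'v) \<Rightarrow> ('x \<Rightarrow> 'v) \<Rightarrow> 'x \<Rightarrow> 'v" where
  "paste f g \<alpha> \<beta> A =
     (if A \<in> Ob (Fib H (Cod C g))
      then inv_ar (Fib K (Dom C f)) (Conn K f g (fob (E (Cod C g)) A))
        \<cdot>\<^bsub>Fib K (Dom C f)\<^esub> far (Pull K f) (\<beta> A)
        \<cdot>\<^bsub>Fib K (Dom C f)\<^esub> \<alpha> (fob (Pull H g) A)
        \<cdot>\<^bsub>Fib K (Dom C f)\<^esub> far (E (Dom C f)) (Conn H f g A)
      else undefined)"

lemma fibre_categories:
  assumes "f \<in> Hom C T X"
  shows "category (Fib H T)" "category (Fib H X)" "category (Fib K T)" "category (Fib K X)"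
  using Hom_Ob[OF assms] H.Fib_category K.Fib_category by auto

lemma fibre_functors:
  assumes "f \<in> Hom C T X"
  shows "is_functor (Fib H X) (Fib H T) (Pull H f)" "is_functor (Fib K X) (Fib K T) (Pull K f)"
    "is_functor (Fib H T) (Fib K T) (E T)" "is_functor (Fib H X) (Fib K X) (E X)"
  using Hom_Ob[OF assms] H.Pull_functor[OF assms] K.Pull_functor[OF assms] E_functor by auto

lemma cellD:
  assumes f: "f \<in> Hom C T X" and \<alpha>: "cell f \<alpha>"
  shows cell_Hom: "A \<in> Ob (Fib H X) \<Longrightarrow>
      \<alpha> A \<in> Hom (Fib K T) (fob (E T) (fob (Pull H f) A)) (fob (Pull K f) (fob (E X) A))"
    and cell_natural: "\<phi> \<in> Hom (Fib H X) A B \<Longrightarrow>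
      \<alpha> B \<cdot>\<^bsub>Fib K T\<^esub> far (E T) (far (Pull H f) \<phi>) = far (Pull K f) (far (E X) \<phi>) \<cdot>\<^bsub>Fib K T\<^esub> \<alpha> A"
    and cell_iso: "A \<in> Ob (Fib H X) \<Longrightarrow> is_iso (Fib K T) (\<alpha> A)"
    and cell_undefined: "A \<notin> Ob (Fib H X) \<Longrightarrow> \<alpha> A = undefined"
proof -
  interpret nat_iso "Fib H X" "Fib K T" "E T \<circ>\<^sub>F Pull H f" "Pull K f \<circ>\<^sub>F E X" \<alpha>
    using f \<alpha> by (auto simp: cell_def Hom_def)
  show "A \<in> Ob (Fib H X) \<Longrightarrow>
      \<alpha> A \<in> Hom (Fib K T) (fob (E T) (fob (Pull H f) A)) (fob (Pull K f) (fob (E X) A))"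
    using component[of A] by (simp add: comp_functr_def)
  show "\<phi> \<in> Hom (Fib H X) A B \<Longrightarrow>
      \<alpha> B \<cdot>\<^bsub>Fib K T\<^esub> far (E T) (far (Pull H f) \<phi>) = far (Pull K f) (far (E X) \<phi>) \<cdot>\<^bsub>Fib K T\<^esub> \<alpha> A"
    using naturality[of \<phi> A B] by (simp add: comp_functr_def)
  show "A \<in> Ob (Fib H X) \<Longrightarrow> is_iso (Fib K T) (\<alpha> A)" by (rule invertible)
  show "A \<notin> Ob (Fib H X) \<Longrightarrow> \<alpha> A = undefined" using f \<alpha> by (auto simp: cell_def Hom_def)
qed

lemma cell_ext:
  assumes "f \<in> Hom C T X" "cell f \<alpha>" "cell f \<beta>" "\<And>A. A \<in> Ob (Fib H X) \<Longrightarrow> \<alpha> A = \<beta> A"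
  shows "\<alpha> = \<beta>"
  using assms cell_undefined by (metis ext)

lemma paste_factors:
  assumes f: "f \<in> Hom C T X" and g: "g \<in> Hom C X V"
    and \<alpha>: "cell f \<alpha>" and \<beta>: "cell g \<beta>" and A: "A \<in> Ob (Fib H V)"
  shows "Conn K f g (fob (E V) A) \<in> Hom (Fib K T) (fob (Pull K (g \<cdot> f)) (fob (E V) A))
        (fob (Pull K f) (fob (Pull K g) (fob (E V) A)))" (is "?k \<in> _")
    and "far (Pull K f) (\<beta> A) \<in> Hom (Fib K T)
        (fob (Pull K f) (fob (E X) (fob (Pull H g) A)))
        (fob (Pull K f) (fob (Pull K g) (fob (E V) A)))" (is "?b \<in> _")
    and "\<alpha> (fob (Pull H g) A) \<in> Hom (Fib K T)
        (fob (E T) (fob (Pull H f) (fob (Pull H g) A)))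
        (fob (Pull K f) (fob (E X) (fob (Pull H g) A)))" (is "?a \<in> _")
    and "far (E T) (Conn H f g A) \<in> Hom (Fib K T)
        (fob (E T) (fob (Pull H (g \<cdot> f)) A))
        (fob (E T) (fob (Pull H f) (fob (Pull H g) A)))" (is "?c \<in> _")
    and "is_iso (Fib K T) (Conn K f g (fob (E V) A))" "is_iso (Fib K T) (far (Pull K f) (\<beta> A))"
      "is_iso (Fib K T) (\<alpha> (fob (Pull H g) A))" "is_iso (Fib K T) (far (E T) (Conn H f g A))"
proof -
  have EA: "fob (E V) A \<in> Ob (Fib K V)"
    using fibre_functors(4)[OF g] A by (rule is_functor.fob_Ob)
  have gA: "fob (Pull H g) A \<in> Ob (Fib H X)" by (rule H.Pull_Ob[OF g A])
  show "?k \<in> Hom (Fib K T) (fob (Pull K (g \<cdot> f)) (fob (E V) A))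
        (fob (Pull K f) (fob (Pull K g) (fob (E V) A)))" "is_iso (Fib K T) ?k"
    by (rule K.Conn_Hom[OF f g EA], rule K.Conn_is_iso[OF f g EA])
  show "?b \<in> Hom (Fib K T) (fob (Pull K f) (fob (E X) (fob (Pull H g) A)))
        (fob (Pull K f) (fob (Pull K g) (fob (E V) A)))"
    by (rule is_functor.far_Hom[OF fibre_functors(2)[OF f] cell_Hom[OF g \<beta> A]])
  show "is_iso (Fib K T) ?b"
    by (rule is_functor.far_iso[OF fibre_functors(2)[OF f] fibre_categories(4)[OF f]
          cell_iso[OF g \<beta> A]])
  show "?a \<in> Hom (Fib K T) (fob (E T) (fob (Pull H f) (fob (Pull H g) A)))
        (fob (Pull K f) (fob (E X) (fob (Pull H g) A)))" "is_iso (Fib K T) ?a"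
    by (rule cell_Hom[OF f \<alpha> gA], rule cell_iso[OF f \<alpha> gA])
  show "?c \<in> Hom (Fib K T) (fob (E T) (fob (Pull H (g \<cdot> f)) A))
        (fob (E T) (fob (Pull H f) (fob (Pull H g) A)))"
    by (rule is_functor.far_Hom[OF fibre_functors(3)[OF f] H.Conn_Hom[OF f g A]])
  show "is_iso (Fib K T) ?c"
    by (rule is_functor.far_iso[OF fibre_functors(3)[OF f] fibre_categories(1)[OF f]
          H.Conn_is_iso[OF f g A]])
qed

text \<open>The equation \<open>Conn_paste\<close> determines the pasting, because connection isomorphisms can be
  cancelled. Later arguments use it in place of the definition, which avoids computing with
  inverses.\<close>

lemma
  assumes f: "f \<in> Hom C T X" and g: "g \<in> Hom C X V"
    and \<alpha>: "cell f \<alpha>" and \<beta>: "cell g \<beta>" and A: "A \<in> Ob (Fib H V)"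
  shows paste_Hom: "paste f g \<alpha> \<beta> A \<in> Hom (Fib K T)
        (fob (E T) (fob (Pull H (g \<cdot> f)) A)) (fob (Pull K (g \<cdot> f)) (fob (E V) A))"
    and paste_iso: "is_iso (Fib K T) (paste f g \<alpha> \<beta> A)"
    and Conn_paste: "Conn K f g (fob (E V) A) \<cdot>\<^bsub>Fib K T\<^esub> paste f g \<alpha> \<beta> A
        = far (Pull K f) (\<beta> A) \<cdot>\<^bsub>Fib K T\<^esub> \<alpha> (fob (Pull H g) A)
          \<cdot>\<^bsub>Fib K T\<^esub> far (E T) (Conn H f g A)"
proof -
  interpret D: category "Fib K T" by (rule fibre_categories(3)[OF f])
  note p = paste_factors[OF assms]
  note inv = D.iso_inverse[OF p(5,1)]
  note ac = D.Comp_Hom[OF p(4,3)]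
  note bac = D.Comp_Hom[OF ac p(2)]
  have eq: "paste f g \<alpha> \<beta> A = inv_ar (Fib K T) (Conn K f g (fob (E V) A))
        \<cdot>\<^bsub>Fib K T\<^esub> far (Pull K f) (\<beta> A) \<cdot>\<^bsub>Fib K T\<^esub> \<alpha> (fob (Pull H g) A)
          \<cdot>\<^bsub>Fib K T\<^esub> far (E T) (Conn H f g A)"
    using f g A by (simp add: paste_def Hom_def)
  show "paste f g \<alpha> \<beta> A \<in> Hom (Fib K T)
        (fob (E T) (fob (Pull H (g \<cdot> f)) A)) (fob (Pull K (g \<cdot> f)) (fob (E V) A))"
    unfolding eq by (rule D.Comp_Hom[OF bac inv(1)])
  show "is_iso (Fib K T) (paste f g \<alpha> \<beta> A)"
    unfolding eq
    by (rule D.iso_comp[OF D.iso_comp[OF D.iso_comp[OF p(8,7,4,3)] p(6) ac p(2)] inv(4) bac inv(1)])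
  show "Conn K f g (fob (E V) A) \<cdot>\<^bsub>Fib K T\<^esub> paste f g \<alpha> \<beta> A
        = far (Pull K f) (\<beta> A) \<cdot>\<^bsub>Fib K T\<^esub> \<alpha> (fob (Pull H g) A)
          \<cdot>\<^bsub>Fib K T\<^esub> far (E T) (Conn H f g A)"
    unfolding eq using D.Comp_assoc[OF bac inv(1) p(1)] inv(3) D.Idt_Comp[OF bac] by simp
qed

text \<open>After composing with the connection isomorphism, naturality of the pasting is naturality of
  its three other factors and of the connection itself, applied one after the other.\<close>

lemma cell_paste:
  assumes f: "f \<in> Hom C T X" and g: "g \<in> Hom C X V" and \<alpha>: "cell f \<alpha>" and \<beta>: "cell g \<beta>"
  shows "cell (g \<cdot> f) (paste f g \<alpha> \<beta>)"
proof -
  note gf = Comp_Hom[OF f g]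
  interpret D: category "Fib K T" by (rule fibre_categories(3)[OF f])
  have "paste f g \<alpha> \<beta> B \<cdot>\<^bsub>Fib K T\<^esub> far (E T) (far (Pull H (g \<cdot> f)) \<phi>)
      = far (Pull K (g \<cdot> f)) (far (E V) \<phi>) \<cdot>\<^bsub>Fib K T\<^esub> paste f g \<alpha> \<beta> A"
    if \<phi>: "\<phi> \<in> Hom (Fib H V) A B" for \<phi> A B
  proof -
    have AB: "A \<in> Ob (Fib H V)" "B \<in> Ob (Fib H V)"
      using category.Hom_Ob[OF fibre_categories(2)[OF g] \<phi>] by auto
    note pA = paste_factors[OF assms AB(1)] and pB = paste_factors[OF assms AB(2)]
    note hA = paste_Hom[OF assms AB(1)] and hB = paste_Hom[OF assms AB(2)]
    note cA = Conn_paste[OF assms AB(1)] and cB = Conn_paste[OF assms AB(2)]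
    let ?l = "far (E T) (far (Pull H (g \<cdot> f)) \<phi>)" and ?r = "far (Pull K (g \<cdot> f)) (far (E V) \<phi>)"
    let ?m = "far (E T) (far (Pull H f) (far (Pull H g) \<phi>))"
    let ?n = "far (Pull K f) (far (E X) (far (Pull H g) \<phi>))"
    let ?o = "far (Pull K f) (far (Pull K g) (far (E V) \<phi>))"
    have E\<phi>: "far (E V) \<phi> \<in> Hom (Fib K V) (fob (E V) A) (fob (E V) B)"
      by (rule is_functor.far_Hom[OF fibre_functors(4)[OF g] \<phi>])
    have g\<phi>: "far (Pull H g) \<phi> \<in> Hom (Fib H X) (fob (Pull H g) A) (fob (Pull H g) B)"
      by (rule is_functor.far_Hom[OF fibre_functors(1)[OF g] \<phi>])
    have gf\<phi>: "far (Pull H (g \<cdot> f)) \<phi>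
        \<in> Hom (Fib H T) (fob (Pull H (g \<cdot> f)) A) (fob (Pull H (g \<cdot> f)) B)"
      by (rule is_functor.far_Hom[OF fibre_functors(1)[OF gf] \<phi>])
    have f\<phi>: "far (Pull H f) (far (Pull H g) \<phi>) \<in> Hom (Fib H T)
        (fob (Pull H f) (fob (Pull H g) A)) (fob (Pull H f) (fob (Pull H g) B))"
      by (rule is_functor.far_Hom[OF fibre_functors(1)[OF f] g\<phi>])
    have l: "?l \<in> Hom (Fib K T) (fob (E T) (fob (Pull H (g \<cdot> f)) A)) (fob (E T) (fob (Pull H (g \<cdot> f)) B))"
      by (rule is_functor.far_Hom[OF fibre_functors(3)[OF f] gf\<phi>])
    have r: "?r \<in> Hom (Fib K T) (fob (Pull K (g \<cdot> f)) (fob (E V) A)) (fob (Pull K (g \<cdot> f)) (fob (E V) B))"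
      by (rule is_functor.far_Hom[OF fibre_functors(2)[OF gf] E\<phi>])
    have m: "?m \<in> Hom (Fib K T) (fob (E T) (fob (Pull H f) (fob (Pull H g) A)))
        (fob (E T) (fob (Pull H f) (fob (Pull H g) B)))"
      by (rule is_functor.far_Hom[OF fibre_functors(3)[OF f] f\<phi>])
    have Eg\<phi>: "far (E X) (far (Pull H g) \<phi>) \<in> Hom (Fib K X)
        (fob (E X) (fob (Pull H g) A)) (fob (E X) (fob (Pull H g) B))"
      by (rule is_functor.far_Hom[OF fibre_functors(4)[OF f] g\<phi>])
    have n: "?n \<in> Hom (Fib K T) (fob (Pull K f) (fob (E X) (fob (Pull H g) A)))
        (fob (Pull K f) (fob (E X) (fob (Pull H g) B)))"
      by (rule is_functor.far_Hom[OF fibre_functors(2)[OF f] Eg\<phi>])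
    have gE\<phi>: "far (Pull K g) (far (E V) \<phi>) \<in> Hom (Fib K X)
        (fob (Pull K g) (fob (E V) A)) (fob (Pull K g) (fob (E V) B))"
      by (rule is_functor.far_Hom[OF fibre_functors(2)[OF g] E\<phi>])
    have o: "?o \<in> Hom (Fib K T) (fob (Pull K f) (fob (Pull K g) (fob (E V) A)))
        (fob (Pull K f) (fob (Pull K g) (fob (E V) B)))"
      by (rule is_functor.far_Hom[OF fibre_functors(2)[OF f] gE\<phi>])
    let ?kA = "Conn K f g (fob (E V) A)" and ?kB = "Conn K f g (fob (E V) B)"
    let ?bA = "far (Pull K f) (\<beta> A)" and ?bB = "far (Pull K f) (\<beta> B)"
    let ?aA = "\<alpha> (fob (Pull H g) A)" and ?aB = "\<alpha> (fob (Pull H g) B)"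
    let ?cA = "far (E T) (Conn H f g A)" and ?cB = "far (E T) (Conn H f g B)"
    have nat_c: "?cB \<cdot>\<^bsub>Fib K T\<^esub> ?l = ?m \<cdot>\<^bsub>Fib K T\<^esub> ?cA"
      using is_functor.far_Comp[OF fibre_functors(3)[OF f] gf\<phi> H.Conn_Hom[OF f g AB(2)]]
        is_functor.far_Comp[OF fibre_functors(3)[OF f] H.Conn_Hom[OF f g AB(1)] f\<phi>]
        H.Conn_natural[OF f g \<phi>] by simp
    have nat_a: "?aB \<cdot>\<^bsub>Fib K T\<^esub> ?m = ?n \<cdot>\<^bsub>Fib K T\<^esub> ?aA"
      by (rule cell_natural[OF f \<alpha> g\<phi>])
    have nat_b: "?bB \<cdot>\<^bsub>Fib K T\<^esub> ?n = ?o \<cdot>\<^bsub>Fib K T\<^esub> ?bA"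
      using is_functor.far_Comp[OF fibre_functors(2)[OF f] Eg\<phi> cell_Hom[OF g \<beta> AB(2)]]
        is_functor.far_Comp[OF fibre_functors(2)[OF f] cell_Hom[OF g \<beta> AB(1)] gE\<phi>]
        cell_natural[OF g \<beta> \<phi>] by simp
    have nat_k: "?kB \<cdot>\<^bsub>Fib K T\<^esub> ?r = ?o \<cdot>\<^bsub>Fib K T\<^esub> ?kA"
      by (rule K.Conn_natural[OF f g E\<phi>])
    have "?kB \<cdot>\<^bsub>Fib K T\<^esub> (paste f g \<alpha> \<beta> B \<cdot>\<^bsub>Fib K T\<^esub> ?l)
        = (?bB \<cdot>\<^bsub>Fib K T\<^esub> ?aB \<cdot>\<^bsub>Fib K T\<^esub> ?cB) \<cdot>\<^bsub>Fib K T\<^esub> ?l"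
      using D.Comp_assoc[OF l hB pB(1)] cB by simp
    also have "\<dots> = ?bB \<cdot>\<^bsub>Fib K T\<^esub> ?aB \<cdot>\<^bsub>Fib K T\<^esub> (?cB \<cdot>\<^bsub>Fib K T\<^esub> ?l)"
      using D.Comp_assoc[OF l D.Comp_Hom[OF pB(4,3)] pB(2)] D.Comp_assoc[OF l pB(4,3)] by simp
    also have "\<dots> = ?bB \<cdot>\<^bsub>Fib K T\<^esub> (?aB \<cdot>\<^bsub>Fib K T\<^esub> ?m) \<cdot>\<^bsub>Fib K T\<^esub> ?cA"
      using nat_c D.Comp_assoc[OF pA(4) m pB(3)] by simp
    also have "\<dots> = (?bB \<cdot>\<^bsub>Fib K T\<^esub> ?n) \<cdot>\<^bsub>Fib K T\<^esub> ?aA \<cdot>\<^bsub>Fib K T\<^esub> ?cA"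
      using nat_a D.Comp_assoc[OF pA(4,3) n] D.Comp_assoc[OF D.Comp_Hom[OF pA(4,3)] n pB(2)] by simp
    also have "\<dots> = ?o \<cdot>\<^bsub>Fib K T\<^esub> (?bA \<cdot>\<^bsub>Fib K T\<^esub> ?aA \<cdot>\<^bsub>Fib K T\<^esub> ?cA)"
      using nat_b D.Comp_assoc[OF D.Comp_Hom[OF pA(4,3)] pA(2) o] by simp
    also have "\<dots> = ?kB \<cdot>\<^bsub>Fib K T\<^esub> (?r \<cdot>\<^bsub>Fib K T\<^esub> paste f g \<alpha> \<beta> A)"
      using cA nat_k D.Comp_assoc[OF hA pA(1) o] D.Comp_assoc[OF hA r pB(1)] by simp
    finally show ?thesis
      by (rule D.iso_cancel_left[OF pB(5,1) D.Comp_Hom[OF l hB] D.Comp_Hom[OF hA r]])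
  qed
  then have "nat_iso (Fib H V) (Fib K T) (E T \<circ>\<^sub>F Pull H (g \<cdot> f)) (Pull K (g \<cdot> f) \<circ>\<^sub>F E V)
      (paste f g \<alpha> \<beta>)"
    using paste_Hom[OF assms] paste_iso[OF assms]
    by unfold_locales (auto simp: comp_functr_def)
  then show ?thesis using HomD[OF gf] HomD[OF g] by (simp add: cell_def paste_def)
qed

text \<open>Composed with the connection isomorphisms to \<open>f\<^sup>* g\<^sup>* h\<^sup>* E A\<close>, both sides become
  \<open>f\<^sup>* g\<^sup>* \<gamma>\<close>, \<open>f\<^sup>* \<beta>\<close> and \<open>\<alpha>\<close> preceded by connections of \<open>H\<close>. The two ways to connect \<open>(h g f)\<^sup>*\<close> with
  \<open>f\<^sup>* g\<^sup>* h\<^sup>*\<close> agree by the cocycle condition, in \<open>H\<close> on the source side and in \<open>K\<close> on the target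
  side.\<close>

lemma paste_assoc:
  assumes f: "f \<in> Hom C T X" and g: "g \<in> Hom C X V" and h: "h \<in> Hom C V W"
    and \<alpha>: "cell f \<alpha>" and \<beta>: "cell g \<beta>" and \<gamma>: "cell h \<gamma>"
  shows "paste (g \<cdot> f) h (paste f g \<alpha> \<beta>) \<gamma> = paste f (h \<cdot> g) \<alpha> (paste g h \<beta> \<gamma>)"
proof (rule cell_ext)
  note gf = Comp_Hom[OF f g] and hg = Comp_Hom[OF g h]
  note ab = cell_paste[OF f g \<alpha> \<beta>] and bc = cell_paste[OF g h \<beta> \<gamma>]
  show hgf: "h \<cdot> g \<cdot> f \<in> Hom C T W" by (rule Comp_Hom[OF gf h])
  have assoc: "(h \<cdot> g) \<cdot> f = h \<cdot> g \<cdot> f" by (rule Comp_assoc[OF f g h])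
  show "cell (h \<cdot> g \<cdot> f) (paste (g \<cdot> f) h (paste f g \<alpha> \<beta>) \<gamma>)"
    by (rule cell_paste[OF gf h ab \<gamma>])
  show "cell (h \<cdot> g \<cdot> f) (paste f (h \<cdot> g) \<alpha> (paste g h \<beta> \<gamma>))"
    using cell_paste[OF f hg \<alpha> bc] assoc by simp
  fix A assume A: "A \<in> Ob (Fib H W)"
  interpret D: category "Fib K T" by (rule fibre_categories(3)[OF f])
  have hA: "fob (Pull H h) A \<in> Ob (Fib H V)" by (rule H.Pull_Ob[OF h A])
  have EA: "fob (E W) A \<in> Ob (Fib K W)"
    using fibre_functors(4)[OF h] A by (rule is_functor.fob_Ob)
  have hEA: "fob (Pull K h) (fob (E W) A) \<in> Ob (Fib K V)" by (rule K.Pull_Ob[OF h EA])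
  note L = paste_factors[OF gf h ab \<gamma> A] paste_Hom[OF gf h ab \<gamma> A] Conn_paste[OF gf h ab \<gamma> A]
  note R = paste_factors[OF f hg \<alpha> bc A, unfolded assoc] paste_Hom[OF f hg \<alpha> bc A, unfolded assoc]
    Conn_paste[OF f hg \<alpha> bc A, unfolded assoc]
  note l = paste_factors[OF f g \<alpha> \<beta> hA] paste_Hom[OF f g \<alpha> \<beta> hA] Conn_paste[OF f g \<alpha> \<beta> hA]
  note r = paste_factors[OF g h \<beta> \<gamma> A] paste_Hom[OF g h \<beta> \<gamma> A] Conn_paste[OF g h \<beta> \<gamma> A]
  note fK = fibre_functors(2)[OF f]
  note ET = fibre_functors(3)[OF f]
  let ?L = "paste (g \<cdot> f) h (paste f g \<alpha> \<beta>) \<gamma> A" and ?R = "paste f (h \<cdot> g) \<alpha> (paste g h \<beta> \<gamma>) A"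
  let ?k = "Conn K f g (fob (Pull K h) (fob (E W) A))"
  let ?\<gamma> = "far (Pull K f) (far (Pull K g) (\<gamma> A))"
  let ?\<beta> = "far (Pull K f) (\<beta> (fob (Pull H h) A))"
  let ?\<alpha> = "\<alpha> (fob (Pull H g) (fob (Pull H h) A))"
  let ?c = "far (E T) (Conn H f g (fob (Pull H h) A))"
  let ?c' = "far (E T) (Conn H (g \<cdot> f) h A)"
  let ?d = "far (Pull K f) (Conn K g h (fob (E W) A))"
  let ?e = "far (E T) (far (Pull H f) (Conn H g h A))"
  let ?e' = "far (E T) (Conn H f (h \<cdot> g) A)"
  note k = K.Conn_Hom[OF f g hEA]
  note d = is_functor.far_Hom[OF fK r(1)]
  note \<gamma>' = is_functor.far_Hom[OF fK r(2)]
  note e0 = is_functor.far_Hom[OF fibre_functors(1)[OF f] H.Conn_Hom[OF g h A]]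
  note e = is_functor.far_Hom[OF ET e0]
  have bcomp: "far (Pull K f) (far (Pull K g) (\<gamma> A) \<cdot>\<^bsub>Fib K X\<^esub> \<beta> (fob (Pull H h) A)
      \<cdot>\<^bsub>Fib K X\<^esub> far (E X) (Conn H g h A))
      = ?\<gamma> \<cdot>\<^bsub>Fib K T\<^esub> ?\<beta> \<cdot>\<^bsub>Fib K T\<^esub> far (Pull K f) (far (E X) (Conn H g h A))"
    using is_functor.far_Comp[OF fK category.Comp_Hom[OF fibre_categories(3)[OF g] r(4,3)] r(2)]
      is_functor.far_Comp[OF fK r(4,3)] by simp
  have "(?k \<cdot>\<^bsub>Fib K T\<^esub> Conn K (g \<cdot> f) h (fob (E W) A)) \<cdot>\<^bsub>Fib K T\<^esub> ?L
      = (?k \<cdot>\<^bsub>Fib K T\<^esub> far (Pull K (g \<cdot> f)) (\<gamma> A)) \<cdot>\<^bsub>Fib K T\<^esub> paste f g \<alpha> \<beta> (fob (Pull H h) A)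
        \<cdot>\<^bsub>Fib K T\<^esub> ?c'"
    using D.Comp_assoc[OF L(9) L(1) k] L(10) D.Comp_assoc[OF D.Comp_Hom[OF L(4,3)] L(2) k] by simp
  also have "\<dots> = ?\<gamma> \<cdot>\<^bsub>Fib K T\<^esub> (Conn K f g (fob (E V) (fob (Pull H h) A))
        \<cdot>\<^bsub>Fib K T\<^esub> paste f g \<alpha> \<beta> (fob (Pull H h) A)) \<cdot>\<^bsub>Fib K T\<^esub> ?c'"
    using K.Conn_natural[OF f g cell_Hom[OF h \<gamma> A]]
      D.Comp_assoc[OF D.Comp_Hom[OF L(4,3)] l(1) \<gamma>'] D.Comp_assoc[OF L(4,3) l(1)] by simp
  also have "\<dots> = ?\<gamma> \<cdot>\<^bsub>Fib K T\<^esub> ?\<beta> \<cdot>\<^bsub>Fib K T\<^esub> ?\<alpha> \<cdot>\<^bsub>Fib K T\<^esub> (?c \<cdot>\<^bsub>Fib K T\<^esub> ?c')"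
    using l(10) D.Comp_assoc[OF L(4) l(4,3)] D.Comp_assoc[OF L(4) D.Comp_Hom[OF l(4,3)] l(2)] by simp
  also have "?c \<cdot>\<^bsub>Fib K T\<^esub> ?c' = ?e \<cdot>\<^bsub>Fib K T\<^esub> ?e'"
    using is_functor.far_Comp[OF ET H.Conn_Hom[OF gf h A] H.Conn_Hom[OF f g hA]]
      is_functor.far_Comp[OF ET H.Conn_Hom[OF f hg A] e0, unfolded assoc]
      H.Conn_cocycle[OF f g h A] by simp
  also have "?\<alpha> \<cdot>\<^bsub>Fib K T\<^esub> (?e \<cdot>\<^bsub>Fib K T\<^esub> ?e') = far (Pull K f) (far (E X) (Conn H g h A))
      \<cdot>\<^bsub>Fib K T\<^esub> \<alpha> (fob (Pull H (h \<cdot> g)) A) \<cdot>\<^bsub>Fib K T\<^esub> ?e'"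
    using D.Comp_assoc[OF R(4) e l(3)] cell_natural[OF f \<alpha> H.Conn_Hom[OF g h A]]
      D.Comp_assoc[OF R(4,3) is_functor.far_Hom[OF fK r(4)]] by simp
  also have "?\<gamma> \<cdot>\<^bsub>Fib K T\<^esub> ?\<beta> \<cdot>\<^bsub>Fib K T\<^esub> far (Pull K f) (far (E X) (Conn H g h A))
      \<cdot>\<^bsub>Fib K T\<^esub> \<alpha> (fob (Pull H (h \<cdot> g)) A) \<cdot>\<^bsub>Fib K T\<^esub> ?e'
      = far (Pull K f) (Conn K g h (fob (E W) A) \<cdot>\<^bsub>Fib K X\<^esub> paste g h \<beta> \<gamma> A)
      \<cdot>\<^bsub>Fib K T\<^esub> \<alpha> (fob (Pull H (h \<cdot> g)) A) \<cdot>\<^bsub>Fib K T\<^esub> ?e'"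
    using r(10) bcomp
      D.Comp_assoc[OF D.Comp_Hom[OF R(4,3)] is_functor.far_Hom[OF fK r(4)] l(2)]
      D.Comp_assoc[OF D.Comp_Hom[OF R(4,3)]
        D.Comp_Hom[OF is_functor.far_Hom[OF fK r(4)] l(2)] \<gamma>'] by simp
  also have "\<dots> = (?d \<cdot>\<^bsub>Fib K T\<^esub> Conn K f (h \<cdot> g) (fob (E W) A)) \<cdot>\<^bsub>Fib K T\<^esub> ?R"
    using is_functor.far_Comp[OF fK r(9) r(1)] D.Comp_assoc[OF D.Comp_Hom[OF R(4,3)] R(2) d]
      D.Comp_assoc[OF R(9) R(1) d] R(10) by simp
  also have "?d \<cdot>\<^bsub>Fib K T\<^esub> Conn K f (h \<cdot> g) (fob (E W) A)
      = ?k \<cdot>\<^bsub>Fib K T\<^esub> Conn K (g \<cdot> f) h (fob (E W) A)"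
    by (rule K.Conn_cocycle[OF f g h EA])
  finally show "?L = ?R"
    by (rule D.iso_cancel_left[OF D.iso_comp[OF L(5) K.Conn_is_iso[OF f g hEA] L(1) k]
          D.Comp_Hom[OF L(1) k] L(9) R(9)])
qed

text \<open>The connections \<open>conn\<^bsub>id,f\<^esub>\<close> can be nontrivial automorphisms, so the unit law is not a matter
  of unfolding definitions. It follows formally: \<open>e * (e * \<beta>) = (e * e) * \<beta> = e * \<beta>\<close>, and pasting with
  \<open>e\<close> on the left is injective because all factors are invertible and \<open>id\<^sup>*\<close> is the identity.\<close>

lemma paste_idempotent_left:
  assumes f: "f \<in> Hom C T X" and \<beta>: "cell f \<beta>" and e: "cell (Idt C T) e"
    and idem: "paste (Idt C T) (Idt C T) e e = e"
  shows "paste (Idt C T) f e \<beta> = \<beta>"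
proof (rule cell_ext[OF f])
  have T: "T \<in> Ob C" using Hom_Ob[OF f] by simp
  note i = Idt_Hom[OF T]
  have fi: "f \<cdot> Idt C T = f" by (rule Comp_Idt[OF f])
  show pb: "cell f (paste (Idt C T) f e \<beta>)" using cell_paste[OF i f e \<beta>] fi by simp
  show "cell f \<beta>" by fact
  have eq: "paste (Idt C T) f e (paste (Idt C T) f e \<beta>) = paste (Idt C T) f e \<beta>"
    using paste_assoc[OF i i f e e \<beta>] idem fi Comp_Idt[OF i] by simp
  fix A assume A: "A \<in> Ob (Fib H X)"
  interpret D: category "Fib K T" by (rule fibre_categories(3)[OF f])
  note p = paste_factors[OF i f e \<beta> A] and q = paste_factors[OF i f e pb A]
  \<comment> \<open>Equal pastings with \<open>e\<close> have equal remaining factors, once \<open>e\<close> and the connections are cancelled.\<close>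
  have "far (Pull K (Idt C T)) (paste (Idt C T) f e \<beta> A) = far (Pull K (Idt C T)) (\<beta> A)"
    using Conn_paste[OF i f e \<beta> A] Conn_paste[OF i f e pb A] eq
    by (intro D.iso_cancel_right[OF D.iso_comp[OF p(8,7,4,3)] D.Comp_Hom[OF p(4,3)] q(2) p(2)]) simp
  then show "paste (Idt C T) f e \<beta> A = \<beta> A"
    using K.Pull_Idt_Ar[OF T] D.HomD[OF cell_Hom[OF f \<beta> A]] D.HomD[OF cell_Hom[OF f pb A]] by simp
qed


text \<open>Pseudonatural isomorphisms between \<open>H\<close> and \<open>K\<close>, restricted to the arrows in \<open>M\<close>.
  Compatibility with composition makes the cells over identities idempotent, hence left units by
  the preceding lemma.\<close>

definition coherent :: "'a set \<Rightarrow> ('a \<Rightarrow> 'x \<Rightarrow> 'v) \<Rightarrow> bool" where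
  "coherent M m \<longleftrightarrow>
     (\<forall>f\<in>M. cell f (m f)) \<and>
     (\<forall>f\<in>M. \<forall>g\<in>M. Cod C f = Dom C g \<longrightarrow> m (g \<cdot> f) = paste f g (m f) (m g)) \<and>
     (\<forall>f. f \<notin> M \<longrightarrow> m f = (\<lambda>A. undefined))"

lemma coherentD:
  assumes "coherent M m"
  shows coherent_cell: "f \<in> M \<Longrightarrow> cell f (m f)"
    and coherent_paste: "f \<in> M \<Longrightarrow> g \<in> M \<Longrightarrow> Cod C f = Dom C g
      \<Longrightarrow> m (g \<cdot> f) = paste f g (m f) (m g)"
    and coherent_undefined: "f \<notin> M \<Longrightarrow> m f = (\<lambda>A. undefined)"
  using assms by (auto simp: coherent_def)

definition exchange_law :: "'a set \<Rightarrow> 'a set \<Rightarrow> ('a \<Rightarrow> 'x \<Rightarrow> 'v) \<Rightarrow> ('a \<Rightarrow> 'x \<Rightarrow> 'v) \<Rightarrow> bool" where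
  "exchange_law Sm Cl msm mcl \<longleftrightarrow>
     (\<forall>p h z q. comm_square C p h z q \<longrightarrow> p \<in> Sm \<longrightarrow> q \<in> Sm \<longrightarrow> z \<in> Cl \<longrightarrow> h \<in> Cl \<longrightarrow>
        paste q z (msm q) (mcl z) = paste h p (mcl h) (msm p))"

definition restrict_to :: "'a set \<Rightarrow> ('a \<Rightarrow> 'x \<Rightarrow> 'v) \<Rightarrow> 'a \<Rightarrow> 'x \<Rightarrow> 'v" where
  "restrict_to M m f = (if f \<in> M then m f else (\<lambda>A. undefined))"

lemma coherent_restrict:
  assumes "coherent (Ar C) m" "wide_subcategory C M"
  shows "coherent M (restrict_to M m)"
proof -
  interpret M: wide_subcategory C M by fact
  have "f \<in> Ar C" if "f \<in> M" for f using M.sub_Ar that by blast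
  then show ?thesis
    using assms(1) M.sub_Comp by (auto simp: coherent_def restrict_to_def)
qed

text \<open>Both sides of the exchange law equal the cell over \<open>p h = z q\<close>.\<close>

lemma exchange_restrict:
  assumes "coherent (Ar C) m"
  shows "exchange_law Sm Cl (restrict_to Sm m) (restrict_to Cl m)"
  unfolding exchange_law_def
proof (intro allI impI)
  fix p h z q
  assume sq: "comm_square C p h z q" and "p \<in> Sm" "q \<in> Sm" "z \<in> Cl" "h \<in> Cl"
  moreover have "paste q z (m q) (m z) = paste h p (m h) (m p)"
    using sq coherent_paste[OF assms, of q z] coherent_paste[OF assms, of h p]
    by (simp add: comm_square_def)
  ultimately show "paste q z (restrict_to Sm m q) (restrict_to Cl m z)
      = paste h p (restrict_to Cl m h) (restrict_to Sm m p)"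
    by (simp add: restrict_to_def)
qed

end

section \<open>Extension from smooth morphisms and closed immersions\<close>

text \<open>The properties of smooth arrows and closed immersions on which the extension argument
  rests: factorizations exist, and any two of the same arrow are dominated by a third. Stated in
  this form, they pass to a product of categories componentwise.\<close>

locale refinable_factorizations = category C + Sm: wide_subcategory C Sm + Cl: wide_subcategory C Cl
  for C :: "('s, 'a) cat" (structure) and Sm Cl :: "'a set" +
  assumes factorization: "f \<in> Ar C \<Longrightarrow> \<exists>p t. p \<in> Sm \<and> t \<in> Cl \<and> Cod C t = Dom C p \<and> f = p \<cdot> t"
    and refinement: "p \<in> Sm \<Longrightarrow> t \<in> Cl \<Longrightarrow> Cod C t = Dom C p \<Longrightarrow>
      p' \<in> Sm \<Longrightarrow> t' \<in> Cl \<Longrightarrow> Cod C t' = Dom C p' \<Longrightarrow> p \<cdot> t = p' \<cdot> t' \<Longrightarrow>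
      \<exists>s\<in>Cl. \<exists>a\<in>Sm. \<exists>a'\<in>Sm. Cod C s = Dom C a \<and> Cod C s = Dom C a' \<and>
        Cod C a = Dom C p \<and> Cod C a' = Dom C p' \<and> a \<cdot> s = t \<and> a' \<cdot> s = t' \<and> p \<cdot> a = p' \<cdot> a'"

locale cell_extension = fibrewise_functors C H K E + refinable_factorizations C Sm Cl
  for C :: "('s, 'a) cat" (structure)
    and H :: "('s, 'a, 'x, 'y) fib_cat" and K :: "('s, 'a, 'u, 'v) fib_cat"
    and E :: "'s \<Rightarrow> ('x, 'y, 'u, 'v) functr" and Sm Cl :: "'a set" +
  fixes msm mcl :: "'a \<Rightarrow> 'x \<Rightarrow> 'v"
  assumes msm: "coherent Sm msm" and mcl: "coherent Cl mcl"
    and exchange: "exchange_law Sm Cl msm mcl"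
begin

lemma Sm_Hom: "p \<in> Sm \<Longrightarrow> p \<in> Hom C (Dom C p) (Cod C p)"
  using Sm.sub_Ar Ar_Hom by blast

lemma Cl_Hom: "t \<in> Cl \<Longrightarrow> t \<in> Hom C (Dom C t) (Cod C t)"
  using Cl.sub_Ar Ar_Hom by blast

lemma exchangeD:
  assumes "q \<in> Sm" "z \<in> Cl" "h \<in> Cl" "p \<in> Sm"
    and "Cod C q = Dom C z" "Cod C h = Dom C p" "p \<cdot> h = z \<cdot> q"
  shows "paste q z (msm q) (mcl z) = paste h p (mcl h) (msm p)"
proof -
  have "Dom C q = Dom C (z \<cdot> q)" "Dom C h = Dom C (p \<cdot> h)"
       "Cod C z = Cod C (z \<cdot> q)" "Cod C p = Cod C (p \<cdot> h)"
    using Comp_Hom[of q _ _ z] Comp_Hom[of h _ _ p] assms Sm_Hom Cl_Hom HomD by metis+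
  then have "comm_square C p h z q"
    using assms Sm.sub_Ar Cl.sub_Ar by (auto simp: comm_square_def)
  with exchange assms show ?thesis by (auto simp: exchange_law_def)
qed

lemma smooth_Idt_paste:
  assumes f: "f \<in> Hom C T X" and \<beta>: "cell f \<beta>"
  shows "paste (Idt C T) f (msm (Idt C T)) \<beta> = \<beta>"
proof -
  have T: "T \<in> Ob C" using Hom_Ob[OF f] by simp
  note i = Sm.sub_Idt[OF T]
  have idem: "paste (Idt C T) (Idt C T) (msm (Idt C T)) (msm (Idt C T)) = msm (Idt C T)"
    using coherent_paste[OF msm i i] HomD[OF Idt_Hom[OF T]] Comp_Idt[OF Idt_Hom[OF T]] by simp
  show ?thesis
    using f \<beta> coherent_cell[OF msm i] idem by (rule paste_idempotent_left)
qed

lemma closed_Idt_paste: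
  assumes f: "f \<in> Hom C T X" and \<beta>: "cell f \<beta>"
  shows "paste (Idt C T) f (mcl (Idt C T)) \<beta> = \<beta>"
proof -
  have T: "T \<in> Ob C" using Hom_Ob[OF f] by simp
  note i = Cl.sub_Idt[OF T]
  have idem: "paste (Idt C T) (Idt C T) (mcl (Idt C T)) (mcl (Idt C T)) = mcl (Idt C T)"
    using coherent_paste[OF mcl i i] HomD[OF Idt_Hom[OF T]] Comp_Idt[OF Idt_Hom[OF T]] by simp
  show ?thesis
    using f \<beta> coherent_cell[OF mcl i] idem by (rule paste_idempotent_left)
qed

text \<open>The exchange law for the square \<open>a s = (a s) id\<close>, in which \<open>a\<close> and the identity are the
  smooth sides; the unit law removes the identity.\<close>

lemma closed_as_composite:
  assumes s: "s \<in> Cl" and a: "a \<in> Sm" and sa: "Cod C s = Dom C a" and as: "a \<cdot> s \<in> Cl"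
  shows "paste s a (mcl s) (msm a) = mcl (a \<cdot> s)"
proof -
  note hom = Cl_Hom[OF as]
  have dom: "Dom C (a \<cdot> s) = Dom C s"
    using Comp_Hom[OF Cl_Hom[OF s]] Sm_Hom[OF a] sa HomD by metis
  have T: "Dom C s \<in> Ob C" using Hom_Ob[OF Cl_Hom[OF s]] by simp
  have "paste (Idt C (Dom C s)) (a \<cdot> s) (msm (Idt C (Dom C s))) (mcl (a \<cdot> s))
      = paste s a (mcl s) (msm a)"
    by (rule exchangeD)
      (use s a as sa dom hom HomD[OF Idt_Hom[OF T]] Comp_Idt[of "a \<cdot> s"] Sm.sub_Idt[OF T] in auto)
  with smooth_Idt_paste[OF hom coherent_cell[OF mcl as]] dom show ?thesis by simp
qed

lemma paste_refine:
  assumes p: "p \<in> Sm" and s: "s \<in> Cl" and a: "a \<in> Sm" and as: "a \<cdot> s \<in> Cl"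
    and sa: "Cod C s = Dom C a" and ap: "Cod C a = Dom C p"
  shows "paste (a \<cdot> s) p (mcl (a \<cdot> s)) (msm p) = paste s (p \<cdot> a) (mcl s) (msm (p \<cdot> a))"
proof -
  have hom: "s \<in> Hom C (Dom C s) (Dom C a)" "a \<in> Hom C (Dom C a) (Dom C p)"
      "p \<in> Hom C (Dom C p) (Cod C p)"
    using Cl_Hom[OF s] Sm_Hom[OF a] Sm_Hom[OF p] sa ap by auto
  show ?thesis
    using paste_assoc[OF hom coherent_cell[OF mcl s] coherent_cell[OF msm a] coherent_cell[OF msm p]]
      closed_as_composite[OF s a sa as] coherent_paste[OF msm a p ap] by simp
qed

lemma paste_factorization_independent:
  assumes "p \<in> Sm" "t \<in> Cl" "Cod C t = Dom C p" "p' \<in> Sm" "t' \<in> Cl" "Cod C t' = Dom C p'"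
    and "p \<cdot> t = p' \<cdot> t'"
  shows "paste t p (mcl t) (msm p) = paste t' p' (mcl t') (msm p')"
proof -
  obtain s a a' where "s \<in> Cl" "a \<in> Sm" "a' \<in> Sm" "Cod C s = Dom C a" "Cod C s = Dom C a'"
    "Cod C a = Dom C p" "Cod C a' = Dom C p'" "a \<cdot> s = t" "a' \<cdot> s = t'" "p \<cdot> a = p' \<cdot> a'"
    using refinement[OF assms] by blast
  then show ?thesis
    using paste_refine[of p s a] paste_refine[of p' s a'] assms by simp
qed

definition extension :: "'a \<Rightarrow> 'x \<Rightarrow> 'v" where
  "extension f =
     (if f \<in> Ar C
      then case SOME (p, t). p \<in> Sm \<and> t \<in> Cl \<and> Cod C t = Dom C p \<and> f = p \<cdot> t of
        (p, t) \<Rightarrow> paste t p (mcl t) (msm p)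
      else (\<lambda>A. undefined))"

lemma composite_Hom:
  assumes "p \<in> Sm" "t \<in> Cl" "Cod C t = Dom C p"
  shows "p \<cdot> t \<in> Hom C (Dom C t) (Cod C p)"
  using Comp_Hom[of t "Dom C t" "Dom C p" p "Cod C p"] Cl_Hom[OF assms(2)] Sm_Hom[OF assms(1)]
    assms(3) by simp

lemma extension_eq:
  assumes "p \<in> Sm" "t \<in> Cl" "Cod C t = Dom C p"
  shows "extension (p \<cdot> t) = paste t p (mcl t) (msm p)"
proof -
  define x where
    "x = (SOME (p', t'). p' \<in> Sm \<and> t' \<in> Cl \<and> Cod C t' = Dom C p' \<and> p \<cdot> t = p' \<cdot> t')"
  obtain p' t' where x: "x = (p', t')" by fastforce
  have "case x of (p', t') \<Rightarrow> p' \<in> Sm \<and> t' \<in> Cl \<and> Cod C t' = Dom C p' \<and> p \<cdot> t = p' \<cdot> t'"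
    unfolding x_def by (rule someI[of _ "(p, t)"]) (use assms in simp)
  then have "paste t' p' (mcl t') (msm p') = paste t p (mcl t) (msm p)"
    using paste_factorization_independent[of p' t' p t] assms x by simp
  then show ?thesis
    using HomD[OF composite_Hom[OF assms]] x by (simp add: extension_def x_def)
qed

text \<open>With \<open>f = p t\<close> and \<open>g = p' t'\<close>, any factorization \<open>t' p = q u\<close> of the middle part yields the
  factorization \<open>g f = (p' q) (u t)\<close>, and the exchange law for the square \<open>t' p = q u\<close> reorders the
  cells.\<close>

lemma extension_paste:
  assumes f: "f \<in> Ar C" and g: "g \<in> Ar C" and fg: "Cod C f = Dom C g"
  shows "extension (g \<cdot> f) = paste f g (extension f) (extension g)"
proof -
  obtain p t where pt: "p \<in> Sm" "t \<in> Cl" "Cod C t = Dom C p" "f = p \<cdot> t"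
    using factorization[OF f] by blast
  obtain p' t' where pt': "p' \<in> Sm" "t' \<in> Cl" "Cod C t' = Dom C p'" "g = p' \<cdot> t'"
    using factorization[OF g] by blast
  have mid: "Cod C p = Dom C t'"
    using HomD[OF composite_Hom[OF pt(1-3)]] HomD[OF composite_Hom[OF pt'(1-3)]] fg pt(4) pt'(4)
    by simp
  have h1: "t \<in> Hom C (Dom C t) (Dom C p)" "p \<in> Hom C (Dom C p) (Cod C p)"
      "t' \<in> Hom C (Cod C p) (Dom C p')" "p' \<in> Hom C (Dom C p') (Cod C p')"
    using Cl_Hom[OF pt(2)] Sm_Hom[OF pt(1)] Cl_Hom[OF pt'(2)] Sm_Hom[OF pt'(1)] pt(3) pt'(3) mid
    by auto
  have "t' \<cdot> p \<in> Ar C" using HomD[OF Comp_Hom[OF h1(2,3)]] by simp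
  then obtain q u where qu: "q \<in> Sm" "u \<in> Cl" "Cod C u = Dom C q" "t' \<cdot> p = q \<cdot> u"
    using factorization by blast
  have ends: "Dom C u = Dom C p" "Cod C q = Dom C p'"
    using HomD[OF composite_Hom[OF qu(1-3)]] HomD[OF Comp_Hom[OF h1(2,3)]] qu(4) by auto
  have h2: "u \<in> Hom C (Dom C p) (Dom C q)" "q \<in> Hom C (Dom C q) (Dom C p')"
    using Cl_Hom[OF qu(2)] Sm_Hom[OF qu(1)] qu(3) ends by auto
  have p'q: "p' \<cdot> q \<in> Sm" and ut: "u \<cdot> t \<in> Cl"
    using Sm.sub_Comp[OF qu(1) pt'(1)] Cl.sub_Comp[OF pt(2) qu(2)] ends pt(3) by auto
  have p'q_hom: "p' \<cdot> q \<in> Hom C (Dom C q) (Cod C p')" by (rule Comp_Hom[OF h2(2) h1(4)])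
  have ut_hom: "u \<cdot> t \<in> Hom C (Dom C t) (Dom C q)" by (rule Comp_Hom[OF h1(1) h2(1)])
  note f_hom = Comp_Hom[OF h1(1,2)]
  note c = coherent_cell[OF msm] coherent_cell[OF mcl]
  note ct = c(2)[OF pt(2)] and cp = c(1)[OF pt(1)] and ct' = c(2)[OF pt'(2)]
    and cp' = c(1)[OF pt'(1)] and cu = c(2)[OF qu(2)] and cq = c(1)[OF qu(1)]
  have gf: "g \<cdot> f = (p' \<cdot> q) \<cdot> (u \<cdot> t)"
    using Comp_assoc[OF f_hom h1(3,4)] Comp_assoc[OF h1(1-3)] qu(4)
      Comp_assoc[OF h1(1) h2] Comp_assoc[OF ut_hom h2(2) h1(4)] pt(4) pt'(4) by simp
  have "extension (g \<cdot> f) = paste (u \<cdot> t) (p' \<cdot> q) (mcl (u \<cdot> t)) (msm (p' \<cdot> q))"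
    using extension_eq[OF p'q ut] gf HomD[OF p'q_hom] HomD[OF ut_hom] by simp
  also have "\<dots> = paste t ((p' \<cdot> q) \<cdot> u) (mcl t) (paste u (p' \<cdot> q) (mcl u) (msm (p' \<cdot> q)))"
    using paste_assoc[OF h1(1) h2(1) p'q_hom ct cu c(1)[OF p'q]]
      coherent_paste[OF mcl pt(2) qu(2)] pt(3) ends by simp
  also have "paste u (p' \<cdot> q) (mcl u) (msm (p' \<cdot> q))
      = paste (q \<cdot> u) p' (paste u q (mcl u) (msm q)) (msm p')"
    using paste_assoc[OF h2 h1(4) cu cq cp'] coherent_paste[OF msm qu(1) pt'(1)] ends by simp
  also have "paste u q (mcl u) (msm q) = paste p t' (msm p) (mcl t')"
    using exchangeD[OF pt(1) pt'(2) qu(2,1) mid qu(3)] qu(4) by simp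
  also have "paste (q \<cdot> u) p' (paste p t' (msm p) (mcl t')) (msm p')
      = paste p g (msm p) (paste t' p' (mcl t') (msm p'))"
    using paste_assoc[OF h1(2-4) cp ct' cp'] qu(4) pt'(4) by simp
  also have "(p' \<cdot> q) \<cdot> u = g \<cdot> p"
    using Comp_assoc[OF h2 h1(4)] Comp_assoc[OF h1(2-4)] qu(4) pt'(4) by simp
  also have "paste t (g \<cdot> p) (mcl t) (paste p g (msm p) (paste t' p' (mcl t') (msm p')))
      = paste f g (paste t p (mcl t) (msm p)) (paste t' p' (mcl t') (msm p'))"
    using paste_assoc[OF h1(1,2) Comp_Hom[OF h1(3,4)] ct cp cell_paste[OF h1(3,4) ct' cp']]
      pt(4) pt'(4) by simp
  finally show ?thesis
    using extension_eq[OF pt(1-3)] extension_eq[OF pt'(1-3)] pt(4) pt'(4) by simp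
qed

lemma coherent_extension: "coherent (Ar C) extension"
proof -
  have "cell f (extension f)" if f: "f \<in> Ar C" for f
  proof -
    obtain p t where pt: "p \<in> Sm" "t \<in> Cl" "Cod C t = Dom C p" "f = p \<cdot> t"
      using factorization[OF f] by blast
    have hom: "t \<in> Hom C (Dom C t) (Dom C p)" "p \<in> Hom C (Dom C p) (Cod C p)"
      using Cl_Hom[OF pt(2)] Sm_Hom[OF pt(1)] pt(3) by auto
    show ?thesis
      using cell_paste[OF hom coherent_cell[OF mcl pt(2)] coherent_cell[OF msm pt(1)]]
        extension_eq[OF pt(1-3)] pt(4) by simp
  qed
  then show ?thesis
    using extension_paste by (auto simp: coherent_def extension_def)
qed

lemma restrict_extension_smooth: "restrict_to Sm extension = msm"
proof (rule ext)
  fix p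
  show "restrict_to Sm extension p = msm p"
  proof (cases "p \<in> Sm")
    case True
    note hom = Sm_Hom[OF True]
    have T: "Dom C p \<in> Ob C" using Hom_Ob[OF hom] by simp
    have "extension p = paste (Idt C (Dom C p)) p (mcl (Idt C (Dom C p))) (msm p)"
      using extension_eq[OF True Cl.sub_Idt[OF T]] HomD[OF Idt_Hom[OF T]]
      unfolding Comp_Idt[OF hom] by blast
    also have "\<dots> = msm p" by (rule closed_Idt_paste[OF hom coherent_cell[OF msm True]])
    finally show ?thesis using True by (simp add: restrict_to_def)
  next
    case False
    then show ?thesis using coherent_undefined[OF msm, of p] by (simp add: restrict_to_def)
  qed
qed

lemma restrict_extension_closed: "restrict_to Cl extension = mcl"
proof (rule ext)
  fix z
  show "restrict_to Cl extension z = mcl z"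
  proof (cases "z \<in> Cl")
    case True
    note hom = Cl_Hom[OF True]
    have X: "Cod C z \<in> Ob C" using Hom_Ob[OF hom] by simp
    note i = HomD[OF Idt_Hom[OF X]] and iz = Idt_Comp[OF hom]
    have "extension z = paste z (Idt C (Cod C z)) (mcl z) (msm (Idt C (Cod C z)))"
      using extension_eq[OF Sm.sub_Idt[OF X] True] i unfolding iz by metis
    also have "\<dots> = mcl z"
      using closed_as_composite[OF True Sm.sub_Idt[OF X]] i True unfolding iz by metis
    finally show ?thesis using True by (simp add: restrict_to_def)
  next
    case False
    then show ?thesis using coherent_undefined[OF mcl, of z] by (simp add: restrict_to_def)
  qed
qed

lemma extension_unique:
  assumes m: "coherent (Ar C) m" and sm: "restrict_to Sm m = msm" and cl: "restrict_to Cl m = mcl"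
  shows "m = extension"
proof (rule ext)
  fix f
  show "m f = extension f"
  proof (cases "f \<in> Ar C")
    case True
    then obtain p t where pt: "p \<in> Sm" "t \<in> Cl" "Cod C t = Dom C p" "f = p \<cdot> t"
      using factorization by blast
    have "m p = msm p" "m t = mcl t"
      using fun_cong[OF sm, of p] fun_cong[OF cl, of t] pt by (simp_all add: restrict_to_def)
    moreover have "m f = paste t p (m t) (m p)"
      using coherent_paste[OF m, of t p] pt Sm.sub_Ar Cl.sub_Ar by auto
    ultimately show ?thesis using extension_eq[OF pt(1-3)] pt(4) by simp
  next
    case False
    then show ?thesis using coherent_undefined[OF m, of f] by (simp add: extension_def)
  qed
qed

theorem extends_iff_extension:
  "coherent (Ar C) m \<and> restrict_to Sm m = msm \<and> restrict_to Cl m = mcl \<longleftrightarrow> m = extension"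
proof
  assume "coherent (Ar C) m \<and> restrict_to Sm m = msm \<and> restrict_to Cl m = mcl"
  then show "m = extension" by (intro extension_unique) simp_all
next
  assume "m = extension"
  then show "coherent (Ar C) m \<and> restrict_to Sm m = msm \<and> restrict_to Cl m = mcl"
    by (simp add: coherent_extension restrict_extension_smooth restrict_extension_closed)
qed

end

section \<open>Products of categories and of fibered categories\<close>

lemma prod_cat_simps [simp]:
  "Ob (prod_cat C D) = Ob C \<times> Ob D" "Ar (prod_cat C D) = Ar C \<times> Ar D"
  "Dom (prod_cat C D) (f, g) = (Dom C f, Dom D g)" "Cod (prod_cat C D) (f, g) = (Cod C f, Cod D g)"
  "Idt (prod_cat C D) (A, B) = (Idt C A, Idt D B)"
  "(f', g') \<cdot>\<^bsub>prod_cat C D\<^esub> (f, g) = (f' \<cdot>\<^bsub>C\<^esub> f, g' \<cdot>\<^bsub>D\<^esub> g)"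
  by (auto simp: prod_cat_def)

lemma Hom_prod_cat [simp]: "Hom (prod_cat C D) (A, A') (B, B') = Hom C A B \<times> Hom D A' B'"
  by (auto simp: Hom_def)

lemma category_prod:
  assumes "category C" "category D"
  shows "category (prod_cat C D)"
proof -
  interpret C: category C by fact
  interpret D: category D by fact
  show ?thesis
    by unfold_locales
      (auto simp: C.Dom_Ob C.Cod_Ob D.Dom_Ob D.Cod_Ob C.Comp_Idt C.Idt_Comp D.Comp_Idt D.Idt_Comp
        intro: C.Idt_Hom D.Idt_Hom C.Comp_Hom D.Comp_Hom C.Comp_assoc D.Comp_assoc)
qed

lemma is_iso_prod:
  assumes "is_iso C f" "is_iso D g"
  shows "is_iso (prod_cat C D) (f, g)"
proof -
  obtain f' g' where "inverse_arrows C f f'" "inverse_arrows D g g'"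
    using assms by (auto simp: is_iso_def)
  then have "inverse_arrows (prod_cat C D) (f, g) (f', g')"
    by (auto simp: inverse_arrows_def)
  then show ?thesis by (auto simp: is_iso_def)
qed

lemma is_functor_prod:
  assumes "is_functor C D F" "is_functor C' D' F'"
  shows "is_functor (prod_cat C C') (prod_cat D D') (F \<otimes>\<^sub>F F')"
proof -
  interpret F: is_functor C D F by fact
  interpret F': is_functor C' D' F' by fact
  show ?thesis
    by unfold_locales
      (auto simp: prod_functr_def F.fob_Ob F'.fob_Ob F.far_Idt F'.far_Idt
        intro: F.far_Hom F'.far_Hom F.far_Comp F'.far_Comp)
qed

lemma wide_subcategory_prod:
  assumes "wide_subcategory C M" "wide_subcategory D N"
  shows "wide_subcategory (prod_cat C D) (M \<times> N)"
proof -
  interpret M: wide_subcategory C M by fact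
  interpret N: wide_subcategory D N by fact
  show ?thesis
    by unfold_locales (use M.sub_Ar N.sub_Ar in \<open>auto simp: M.sub_Idt N.sub_Idt M.sub_Comp N.sub_Comp\<close>)
qed

lemma refinable_factorizations_prod:
  assumes "refinable_factorizations C Sm Cl" "refinable_factorizations D Sm' Cl'"
  shows "refinable_factorizations (prod_cat C D) (Sm \<times> Sm') (Cl \<times> Cl')"
proof -
  interpret C: refinable_factorizations C Sm Cl by fact
  interpret D: refinable_factorizations D Sm' Cl' by fact
  interpret category "prod_cat C D" by (rule category_prod) unfold_locales
  interpret Sm: wide_subcategory "prod_cat C D" "Sm \<times> Sm'"
    by (rule wide_subcategory_prod) unfold_locales
  interpret Cl: wide_subcategory "prod_cat C D" "Cl \<times> Cl'"
    by (rule wide_subcategory_prod) unfold_locales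
  show ?thesis
  proof
    fix f assume "f \<in> Ar (prod_cat C D)"
    then obtain f1 f2 where f: "f = (f1, f2)" "f1 \<in> Ar C" "f2 \<in> Ar D" by auto
    obtain p1 t1 where 1: "p1 \<in> Sm" "t1 \<in> Cl" "Cod C t1 = Dom C p1" "f1 = p1 \<cdot>\<^bsub>C\<^esub> t1"
      using C.factorization[OF f(2)] by blast
    obtain p2 t2 where 2: "p2 \<in> Sm'" "t2 \<in> Cl'" "Cod D t2 = Dom D p2" "f2 = p2 \<cdot>\<^bsub>D\<^esub> t2"
      using D.factorization[OF f(3)] by blast
    show "\<exists>p t. p \<in> Sm \<times> Sm' \<and> t \<in> Cl \<times> Cl' \<and>
        Cod (prod_cat C D) t = Dom (prod_cat C D) p \<and> f = p \<cdot>\<^bsub>prod_cat C D\<^esub> t"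
      by (intro exI[of _ "(p1, p2)"] exI[of _ "(t1, t2)"]) (simp add: f 1 2)
  next
    fix p t p' t'
    assume a: "p \<in> Sm \<times> Sm'" "t \<in> Cl \<times> Cl'" "Cod (prod_cat C D) t = Dom (prod_cat C D) p"
      "p' \<in> Sm \<times> Sm'" "t' \<in> Cl \<times> Cl'" "Cod (prod_cat C D) t' = Dom (prod_cat C D) p'"
      "p \<cdot>\<^bsub>prod_cat C D\<^esub> t = p' \<cdot>\<^bsub>prod_cat C D\<^esub> t'"
    obtain p1 p2 t1 t2 p1' p2' t1' t2' where
      eq: "p = (p1, p2)" "t = (t1, t2)" "p' = (p1', p2')" "t' = (t1', t2')"
      by fastforce
    obtain s1 a1 a1' where 1: "s1 \<in> Cl" "a1 \<in> Sm" "a1' \<in> Sm" "Cod C s1 = Dom C a1"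
      "Cod C s1 = Dom C a1'" "Cod C a1 = Dom C p1" "Cod C a1' = Dom C p1'" "a1 \<cdot>\<^bsub>C\<^esub> s1 = t1"
      "a1' \<cdot>\<^bsub>C\<^esub> s1 = t1'" "p1 \<cdot>\<^bsub>C\<^esub> a1 = p1' \<cdot>\<^bsub>C\<^esub> a1'"
      using C.refinement[of p1 t1 p1' t1'] a eq by auto
    obtain s2 a2 a2' where 2: "s2 \<in> Cl'" "a2 \<in> Sm'" "a2' \<in> Sm'" "Cod D s2 = Dom D a2"
      "Cod D s2 = Dom D a2'" "Cod D a2 = Dom D p2" "Cod D a2' = Dom D p2'" "a2 \<cdot>\<^bsub>D\<^esub> s2 = t2"
      "a2' \<cdot>\<^bsub>D\<^esub> s2 = t2'" "p2 \<cdot>\<^bsub>D\<^esub> a2 = p2' \<cdot>\<^bsub>D\<^esub> a2'"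
      using D.refinement[of p2 t2 p2' t2'] a eq by auto
    show "\<exists>s\<in>Cl \<times> Cl'. \<exists>a\<in>Sm \<times> Sm'. \<exists>a'\<in>Sm \<times> Sm'.
        Cod (prod_cat C D) s = Dom (prod_cat C D) a \<and> Cod (prod_cat C D) s = Dom (prod_cat C D) a' \<and>
        Cod (prod_cat C D) a = Dom (prod_cat C D) p \<and> Cod (prod_cat C D) a' = Dom (prod_cat C D) p' \<and>
        a \<cdot>\<^bsub>prod_cat C D\<^esub> s = t \<and> a' \<cdot>\<^bsub>prod_cat C D\<^esub> s = t' \<and>
        p \<cdot>\<^bsub>prod_cat C D\<^esub> a = p' \<cdot>\<^bsub>prod_cat C D\<^esub> a'"
      by (rule bexI[of _ "(s1, s2)"], rule bexI[of _ "(a1, a2)"], rule bexI[of _ "(a1', a2')"])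
        (use 1 2 in \<open>auto simp: eq\<close>)
  qed
qed

text \<open>The common refinement is the arrow to the fibered product of \<open>p\<close> and \<open>p'\<close>. Its composite with
  a projection is \<open>t\<close>, a closed immersion, so it is one itself.\<close>

lemma (in smooth_closed) refinable_factorizations: "refinable_factorizations S Sm Cl"
proof -
  interpret Sm: wide_subcategory S Sm by (rule Sm_sub)
  interpret Cl: wide_subcategory S Cl by (rule Cl_sub)
  show ?thesis
  proof
    show "\<exists>p t. p \<in> Sm \<and> t \<in> Cl \<and> Cod S t = Dom S p \<and> f = p \<cdot> t" if "f \<in> Ar S" for f
      using that by (rule factorization)
    fix p t p' t'
    assume p: "p \<in> Sm" and t: "t \<in> Cl" and tp: "Cod S t = Dom S p"
      and p': "p' \<in> Sm" and t': "t' \<in> Cl" and tp': "Cod S t' = Dom S p'"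
      and eq: "p \<cdot> t = p' \<cdot> t'"
    have hom: "t \<in> Hom S (Dom S t) (Dom S p)" "p \<in> Hom S (Dom S p) (Cod S p)"
      "t' \<in> Hom S (Dom S t') (Dom S p')" "p' \<in> Hom S (Dom S p') (Cod S p')"
      using Cl.sub_Ar Sm.sub_Ar p t tp p' t' tp' by (auto simp: Hom_def)
    have ends: "Dom S t' = Dom S t" "Cod S p' = Cod S p"
      using HomD[OF Comp_Hom[OF hom(1,2)]] HomD[OF Comp_Hom[OF hom(3,4)]] eq by auto
    obtain a a' where sq: "cartesian_square S p a p' a'"
      using Sm_fibered_product[OF p] Sm.sub_Ar p' ends(2) by blast
    have com: "comm_square S p a p' a'" using sq by (simp add: cartesian_square_def)
    have a'_Sm: "a' \<in> Sm" by (rule Sm_base_change[OF p sq])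
    have "cartesian_square S p' a' p a"
      using sq unfolding cartesian_square_def comm_square_def by metis
    then have a_Sm: "a \<in> Sm" by (rule Sm_base_change[OF p'])
    obtain s where s: "s \<in> Hom S (Dom S t) (Dom S a')" "a \<cdot> s = t" "a' \<cdot> s = t'"
      using sq hom(1,3) ends eq unfolding cartesian_square_def by metis
    have "s \<in> Cl"
      using Cl_cancel[of s a] s t com by (auto simp: Hom_def comm_square_def)
    moreover have "Cod S s = Dom S a \<and> Cod S s = Dom S a' \<and>
        Cod S a = Dom S p \<and> Cod S a' = Dom S p' \<and> a \<cdot> s = t \<and> a' \<cdot> s = t' \<and> p \<cdot> a = p' \<cdot> a'"
      using s com by (auto simp: Hom_def comm_square_def)
    ultimately show "\<exists>s\<in>Cl. \<exists>a\<in>Sm. \<exists>a'\<in>Sm. Cod S s = Dom S a \<and> Cod S s = Dom S a' \<and>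
        Cod S a = Dom S p \<and> Cod S a' = Dom S p' \<and> a \<cdot> s = t \<and> a' \<cdot> s = t' \<and> p \<cdot> a = p' \<cdot> a'"
      using a_Sm a'_Sm by blast
  qed
qed

locale category_with_products = category S + binary_products S P
  for S :: "('s, 'a) cat" (structure) and P :: "('s, 'a) prod_data"
begin

lemma
  assumes f: "f1 \<in> Hom S T1 X1" "f2 \<in> Hom S T2 X2"
  shows prd_ar_Hom: "prd_ar S P f1 f2 \<in> Hom S (Prd P T1 T2) (Prd P X1 X2)"
    and pr1_prd_ar: "pr1 P X1 X2 \<cdot> prd_ar S P f1 f2 = f1 \<cdot> pr1 P T1 T2"
    and pr2_prd_ar: "pr2 P X1 X2 \<cdot> prd_ar S P f1 f2 = f2 \<cdot> pr2 P T1 T2"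
    and prd_ar_unique: "h \<in> Hom S (Prd P T1 T2) (Prd P X1 X2) \<Longrightarrow>
      pr1 P X1 X2 \<cdot> h = f1 \<cdot> pr1 P T1 T2 \<Longrightarrow> pr2 P X1 X2 \<cdot> h = f2 \<cdot> pr2 P T1 T2 \<Longrightarrow>
      prd_ar S P f1 f2 = h"
proof -
  have Ob: "T1 \<in> Ob S" "X1 \<in> Ob S" "T2 \<in> Ob S" "X2 \<in> Ob S"
    using Hom_Ob[OF f(1)] Hom_Ob[OF f(2)] by auto
  have ex1: "\<exists>!h. h \<in> Hom S (Prd P T1 T2) (Prd P X1 X2) \<and>
      pr1 P X1 X2 \<cdot> h = f1 \<cdot> pr1 P T1 T2 \<and> pr2 P X1 X2 \<cdot> h = f2 \<cdot> pr2 P T1 T2"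
    by (rule Prd_universal[OF Ob(2,4) Comp_Hom[OF pr1_Hom[OF Ob(1,3)] f(1)]
          Comp_Hom[OF pr2_Hom[OF Ob(1,3)] f(2)]])
  have eq: "prd_ar S P f1 f2 = (THE h. h \<in> Hom S (Prd P T1 T2) (Prd P X1 X2) \<and>
      pr1 P X1 X2 \<cdot> h = f1 \<cdot> pr1 P T1 T2 \<and> pr2 P X1 X2 \<cdot> h = f2 \<cdot> pr2 P T1 T2)"
    using f by (simp add: prd_ar_def Hom_def)
  show "prd_ar S P f1 f2 \<in> Hom S (Prd P T1 T2) (Prd P X1 X2)"
    "pr1 P X1 X2 \<cdot> prd_ar S P f1 f2 = f1 \<cdot> pr1 P T1 T2"
    "pr2 P X1 X2 \<cdot> prd_ar S P f1 f2 = f2 \<cdot> pr2 P T1 T2"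
    unfolding eq using theI'[OF ex1] by auto
  show "h \<in> Hom S (Prd P T1 T2) (Prd P X1 X2) \<Longrightarrow> pr1 P X1 X2 \<cdot> h = f1 \<cdot> pr1 P T1 T2 \<Longrightarrow>
      pr2 P X1 X2 \<cdot> h = f2 \<cdot> pr2 P T1 T2 \<Longrightarrow> prd_ar S P f1 f2 = h"
    unfolding eq by (rule the1_equality[OF ex1]) auto
qed

lemma prd_ar_Idt:
  assumes "X1 \<in> Ob S" "X2 \<in> Ob S"
  shows "prd_ar S P (Idt S X1) (Idt S X2) = Idt S (Prd P X1 X2)"
proof (rule prd_ar_unique[OF Idt_Hom[OF assms(1)] Idt_Hom[OF assms(2)]])
  show "Idt S (Prd P X1 X2) \<in> Hom S (Prd P X1 X2) (Prd P X1 X2)"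
    by (rule Idt_Hom[OF Prd_Ob[OF assms]])
qed (simp_all add: Comp_Idt[OF pr1_Hom[OF assms]] Idt_Comp[OF pr1_Hom[OF assms]]
    Comp_Idt[OF pr2_Hom[OF assms]] Idt_Comp[OF pr2_Hom[OF assms]])

lemma prd_ar_Comp:
  assumes f: "f1 \<in> Hom S T1 X1" "f2 \<in> Hom S T2 X2" and g: "g1 \<in> Hom S X1 V1" "g2 \<in> Hom S X2 V2"
  shows "prd_ar S P (g1 \<cdot> f1) (g2 \<cdot> f2) = prd_ar S P g1 g2 \<cdot> prd_ar S P f1 f2"
proof (rule prd_ar_unique[OF Comp_Hom[OF f(1) g(1)] Comp_Hom[OF f(2) g(2)]])
  have Ob: "T1 \<in> Ob S" "X1 \<in> Ob S" "V1 \<in> Ob S" "T2 \<in> Ob S" "X2 \<in> Ob S" "V2 \<in> Ob S"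
    using Hom_Ob[OF f(1)] Hom_Ob[OF f(2)] Hom_Ob[OF g(1)] Hom_Ob[OF g(2)] by auto
  show "prd_ar S P g1 g2 \<cdot> prd_ar S P f1 f2 \<in> Hom S (Prd P T1 T2) (Prd P V1 V2)"
    by (rule Comp_Hom[OF prd_ar_Hom[OF f] prd_ar_Hom[OF g]])
  show "pr1 P V1 V2 \<cdot> prd_ar S P g1 g2 \<cdot> prd_ar S P f1 f2 = (g1 \<cdot> f1) \<cdot> pr1 P T1 T2"
    using Comp_assoc[OF prd_ar_Hom[OF f] prd_ar_Hom[OF g] pr1_Hom[OF Ob(3,6)]] pr1_prd_ar[OF f]
      pr1_prd_ar[OF g] Comp_assoc[OF prd_ar_Hom[OF f] pr1_Hom[OF Ob(2,5)] g(1)]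
      Comp_assoc[OF pr1_Hom[OF Ob(1,4)] f(1) g(1)] by simp
  show "pr2 P V1 V2 \<cdot> prd_ar S P g1 g2 \<cdot> prd_ar S P f1 f2 = (g2 \<cdot> f2) \<cdot> pr2 P T1 T2"
    using Comp_assoc[OF prd_ar_Hom[OF f] prd_ar_Hom[OF g] pr2_Hom[OF Ob(3,6)]] pr2_prd_ar[OF f]
      pr2_prd_ar[OF g] Comp_assoc[OF prd_ar_Hom[OF f] pr2_Hom[OF Ob(2,5)] g(2)]
      Comp_assoc[OF pr2_Hom[OF Ob(1,4)] f(2) g(2)] by simp
qed

end

text \<open>The two fibered categories over \<open>S \<times> S\<close> between which an external product acts: the source has
  fibres \<open>H(X\<^sub>1) \<times> H(X\<^sub>2)\<close>, the target is the pullback of \<open>H\<close> along the functor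
  \<open>(X\<^sub>1, X\<^sub>2) \<mapsto> X\<^sub>1 \<times> X\<^sub>2\<close>.\<close>

definition pair_fibration :: "('s, 'a, 'x, 'y) fib_cat \<Rightarrow> ('s \<times> 's, 'a \<times> 'a, 'x \<times> 'x, 'y \<times> 'y) fib_cat"
  where "pair_fibration H =
    \<lparr> Fib = (\<lambda>(X1, X2). prod_cat (Fib H X1) (Fib H X2)),
      Pull = (\<lambda>(f1, f2). Pull H f1 \<otimes>\<^sub>F Pull H f2),
      Conn = (\<lambda>(f1, f2) (g1, g2) (A1, A2). (Conn H f1 g1 A1, Conn H f2 g2 A2)) \<rparr>"

definition product_fibration :: "('s, 'a) cat \<Rightarrow> ('s, 'a) prod_data \<Rightarrow> ('s, 'a, 'x, 'y) fib_cat
    \<Rightarrow> ('s \<times> 's, 'a \<times> 'a, 'x, 'y) fib_cat"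
  where "product_fibration S P H =
    \<lparr> Fib = (\<lambda>(X1, X2). Fib H (Prd P X1 X2)),
      Pull = (\<lambda>(f1, f2). Pull H (prd_ar S P f1 f2)),
      Conn = (\<lambda>(f1, f2) (g1, g2). Conn H (prd_ar S P f1 f2) (prd_ar S P g1 g2)) \<rparr>"

lemma pair_fibration_simps [simp]:
  "Fib (pair_fibration H) (X1, X2) = prod_cat (Fib H X1) (Fib H X2)"
  "Pull (pair_fibration H) (f1, f2) = Pull H f1 \<otimes>\<^sub>F Pull H f2"
  "Conn (pair_fibration H) (f1, f2) (g1, g2) (A1, A2) = (Conn H f1 g1 A1, Conn H f2 g2 A2)"
  by (simp_all add: pair_fibration_def)

lemma product_fibration_simps [simp]:
  "Fib (product_fibration S P H) (X1, X2) = Fib H (Prd P X1 X2)"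
  "Pull (product_fibration S P H) (f1, f2) = Pull H (prd_ar S P f1 f2)"
  "Conn (product_fibration S P H) (f1, f2) (g1, g2) = Conn H (prd_ar S P f1 f2) (prd_ar S P g1 g2)"
  by (simp_all add: product_fibration_def)

lemma prod_functr_simps [simp]:
  "fob (F \<otimes>\<^sub>F G) (A, B) = (fob F A, fob G B)" "far (F \<otimes>\<^sub>F G) (f, g) = (far F f, far G g)"
  by (simp_all add: prod_functr_def)

lemma comp_functr_simps [simp]:
  "fob (F \<circ>\<^sub>F G) A = fob F (fob G A)" "far (F \<circ>\<^sub>F G) f = far F (far G f)"
  by (simp_all add: comp_functr_def)

lemma (in fibered_category) fibered_category_pair:
  "fibered_category (prod_cat S S) (pair_fibration H)"
proof (rule fibered_category.intro)
  fix X assume "X \<in> Ob (prod_cat S S)"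
  then show "category (Fib (pair_fibration H) X)"
    by (cases X) (simp add: category_prod Fib_category)
next
  fix f T X assume "f \<in> Hom (prod_cat S S) T X"
  then show "is_functor (Fib (pair_fibration H) X) (Fib (pair_fibration H) T) (Pull (pair_fibration H) f)"
    by (cases f; cases T; cases X) (auto intro: is_functor_prod Pull_functor)
next
  fix f T X g V assume "f \<in> Hom (prod_cat S S) T X" "g \<in> Hom (prod_cat S S) X V"
  moreover obtain f1 f2 g1 g2 T1 T2 X1 X2 V1 V2 where
    [simp]: "f = (f1, f2)" "g = (g1, g2)" "T = (T1, T2)" "X = (X1, X2)" "V = (V1, V2)"
    by fastforce
  ultimately have fg: "f1 \<in> Hom S T1 X1" "g1 \<in> Hom S X1 V1" "f2 \<in> Hom S T2 X2" "g2 \<in> Hom S X2 V2"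
    by auto
  show "nat_iso (Fib (pair_fibration H) V) (Fib (pair_fibration H) T)
      (Pull (pair_fibration H) (g \<cdot>\<^bsub>prod_cat S S\<^esub> f))
      (Pull (pair_fibration H) f \<circ>\<^sub>F Pull (pair_fibration H) g) (Conn (pair_fibration H) f g)"
    by unfold_locales
      (auto intro: Conn_Hom[OF fg(1,2)] Conn_Hom[OF fg(3,4)] Conn_natural[OF fg(1,2)]
        Conn_natural[OF fg(3,4)] intro!: is_iso_prod Conn_is_iso[OF fg(1,2)] Conn_is_iso[OF fg(3,4)])
next
  fix X A assume "X \<in> Ob (prod_cat S S)" "A \<in> Ob (Fib (pair_fibration H) X)"
  then show "fob (Pull (pair_fibration H) (Idt (prod_cat S S) X)) A = A"
    by (auto simp: Pull_Idt_Ob)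
next
  fix X \<phi> assume "X \<in> Ob (prod_cat S S)" "\<phi> \<in> Ar (Fib (pair_fibration H) X)"
  then show "far (Pull (pair_fibration H) (Idt (prod_cat S S) X)) \<phi> = \<phi>"
    by (auto simp: Pull_Idt_Ar)
next
  fix f T X g V h W A
  assume "f \<in> Hom (prod_cat S S) T X" "g \<in> Hom (prod_cat S S) X V" "h \<in> Hom (prod_cat S S) V W"
    "A \<in> Ob (Fib (pair_fibration H) W)"
  then show "far (Pull (pair_fibration H) f) (Conn (pair_fibration H) g h A)
      \<cdot>\<^bsub>Fib (pair_fibration H) T\<^esub> Conn (pair_fibration H) f (h \<cdot>\<^bsub>prod_cat S S\<^esub> g) A
      = Conn (pair_fibration H) f g (fob (Pull (pair_fibration H) h) A)
      \<cdot>\<^bsub>Fib (pair_fibration H) T\<^esub> Conn (pair_fibration H) (g \<cdot>\<^bsub>prod_cat S S\<^esub> f) h A"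
    by (cases f; cases T; cases X; cases g; cases V; cases h; cases W; cases A)
      (auto intro: Conn_cocycle)
qed

lemma (in category_with_products) fibered_category_product:
  assumes "fibered_category S H"
  shows "fibered_category (prod_cat S S) (product_fibration S P H)"
proof -
  interpret fibered_category S H by fact
  show ?thesis
  proof (rule fibered_category.intro)
    fix X assume "X \<in> Ob (prod_cat S S)"
    then show "category (Fib (product_fibration S P H) X)"
      by (cases X) (simp add: Prd_Ob Fib_category)
  next
    fix f T X assume "f \<in> Hom (prod_cat S S) T X"
    then show "is_functor (Fib (product_fibration S P H) X) (Fib (product_fibration S P H) T)
        (Pull (product_fibration S P H) f)"
      by (cases f; cases T; cases X) (auto intro: prd_ar_Hom Pull_functor)
  next
    fix f T X g V assume "f \<in> Hom (prod_cat S S) T X" "g \<in> Hom (prod_cat S S) X V"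
    then show "nat_iso (Fib (product_fibration S P H) V) (Fib (product_fibration S P H) T)
        (Pull (product_fibration S P H) (g \<cdot>\<^bsub>prod_cat S S\<^esub> f))
        (Pull (product_fibration S P H) f \<circ>\<^sub>F Pull (product_fibration S P H) g)
        (Conn (product_fibration S P H) f g)"
      by (cases f; cases T; cases X; cases g; cases V)
        (auto simp: prd_ar_Comp intro!: Conn_iso intro: prd_ar_Hom)
  next
    fix X A assume "X \<in> Ob (prod_cat S S)" "A \<in> Ob (Fib (product_fibration S P H) X)"
    then show "fob (Pull (product_fibration S P H) (Idt (prod_cat S S) X)) A = A"
      by (auto simp: Pull_Idt_Ob prd_ar_Idt Prd_Ob)
  next
    fix X \<phi> assume "X \<in> Ob (prod_cat S S)" "\<phi> \<in> Ar (Fib (product_fibration S P H) X)"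
    then show "far (Pull (product_fibration S P H) (Idt (prod_cat S S) X)) \<phi> = \<phi>"
      by (auto simp: Pull_Idt_Ar prd_ar_Idt Prd_Ob)
  next
    fix f T X g V h W A
    assume "f \<in> Hom (prod_cat S S) T X" "g \<in> Hom (prod_cat S S) X V" "h \<in> Hom (prod_cat S S) V W"
      "A \<in> Ob (Fib (product_fibration S P H) W)"
    then show "far (Pull (product_fibration S P H) f) (Conn (product_fibration S P H) g h A)
        \<cdot>\<^bsub>Fib (product_fibration S P H) T\<^esub> Conn (product_fibration S P H) f (h \<cdot>\<^bsub>prod_cat S S\<^esub> g) A
        = Conn (product_fibration S P H) f g (fob (Pull (product_fibration S P H) h) A)
        \<cdot>\<^bsub>Fib (product_fibration S P H) T\<^esub> Conn (product_fibration S P H) (g \<cdot>\<^bsub>prod_cat S S\<^esub> f) h A"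
      by (cases f; cases T; cases X; cases g; cases V; cases h; cases W)
        (auto simp: prd_ar_Comp intro!: Conn_cocycle intro: prd_ar_Hom)
  qed
qed

section \<open>External tensor structures as families of cells\<close>

locale tensor_setting = category_with_products S P + fib: fibered_category S H
  for S :: "('s, 'a) cat" (structure) and P :: "('s, 'a) prod_data"
    and H :: "('s, 'a, 'x, 'y) fib_cat" +
  fixes E :: "('s, 'x, 'y) ext_prod"
  assumes ext_functor: "X1 \<in> Ob S \<Longrightarrow> X2 \<in> Ob S \<Longrightarrow>
      is_functor (prod_cat (Fib H X1) (Fib H X2)) (Fib H (Prd P X1 X2)) (E X1 X2)"

sublocale tensor_setting \<subseteq> two: fibrewise_functors "prod_cat S S" "pair_fibration H"
    "product_fibration S P H" "case_prod E"
proof (rule fibrewise_functors.intro)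
  show "category (prod_cat S S)" by (rule category_prod) unfold_locales
  show "fibered_category (prod_cat S S) (pair_fibration H)" by (rule fib.fibered_category_pair)
  show "fibered_category (prod_cat S S) (product_fibration S P H)"
    by (rule fibered_category_product) unfold_locales
  show "fibrewise_functors_axioms (prod_cat S S) (pair_fibration H) (product_fibration S P H)
      (case_prod E)"
    by (rule fibrewise_functors_axioms.intro) (auto intro: ext_functor)
qed

context tensor_setting
begin

lemma paste_eq_two_step:
  "two.paste (f1, f2) (g1, g2) (m f1 f2) (n g1 g2) (A1, A2) =
    (if A1 \<in> Ob (Fib H (Cod S g1)) \<and> A2 \<in> Ob (Fib H (Cod S g2))
     then two_step S P H E m n f1 f2 g1 g2 A1 A2 else undefined)"
  by (simp add: two.paste_def two_step_def Let_def)

text \<open>The naturality and invertibility of \<open>m\<close> at \<open>(f\<^sub>1, f\<^sub>2)\<close> say that it is a cell over this arrow of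
  \<open>S \<times> S\<close>, and \<open>two_step\<close> is pasting there.\<close>

lemma ext_tensor_structure_iff_coherent:
  assumes M: "wide_subcategory S M"
  shows "ext_tensor_structure S P H M E m \<longleftrightarrow> two.coherent (M \<times> M) (case_prod m)"
proof
  interpret M: wide_subcategory S M by fact
  assume "ext_tensor_structure S P H M E m"
  then interpret m: ext_tensor_structure S P H M E m .
  have "two.cell (f1, f2) (m f1 f2)" if "f1 \<in> M" "f2 \<in> M" for f1 f2
    using m.mon_iso[OF that Ar_Hom Ar_Hom] that M.sub_Ar m.mon_extensional
    by (auto simp: two.cell_def)
  moreover have "m (g1 \<cdot> f1) (g2 \<cdot> f2) = two.paste (f1, f2) (g1, g2) (m f1 f2) (m g1 g2)"
    if fg: "f1 \<in> M" "f2 \<in> M" "g1 \<in> M" "g2 \<in> M" "Cod S f1 = Dom S g1" "Cod S f2 = Dom S g2"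
    for f1 f2 g1 g2
  proof (rule ext, clarify)
    fix A1 A2
    have hom: "f1 \<in> Hom S (Dom S f1) (Cod S f1)" "g1 \<in> Hom S (Cod S f1) (Cod S g1)"
      "f2 \<in> Hom S (Dom S f2) (Cod S f2)" "g2 \<in> Hom S (Cod S f2) (Cod S g2)"
      using fg M.sub_Ar by (auto simp: Hom_def)
    have "g1 \<cdot> f1 \<in> Hom S (Dom S f1) (Cod S g1)" "g2 \<cdot> f2 \<in> Hom S (Dom S f2) (Cod S g2)"
      by (rule Comp_Hom[OF hom(1,2)], rule Comp_Hom[OF hom(3,4)])
    then show "m (g1 \<cdot> f1) (g2 \<cdot> f2) (A1, A2)
        = two.paste (f1, f2) (g1, g2) (m f1 f2) (m g1 g2) (A1, A2)"
      using m.mon_comp[OF fg] m.mon_extensional[of "g1 \<cdot> f1" "g2 \<cdot> f2" A1 A2]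
      by (auto simp: paste_eq_two_step Hom_def)
  qed
  moreover have "m f1 f2 = (\<lambda>A. undefined)" if "(f1, f2) \<notin> M \<times> M" for f1 f2
    using m.mon_extensional[of f1 f2] that by auto
  ultimately show "two.coherent (M \<times> M) (case_prod m)"
    by (auto simp: two.coherent_def)
next
  interpret M: wide_subcategory S M by fact
  assume coh: "two.coherent (M \<times> M) (case_prod m)"
  show "ext_tensor_structure S P H M E m"
  proof (rule ext_tensor_structure.intro)
    show "is_functor (prod_cat (Fib H X1) (Fib H X2)) (Fib H (Prd P X1 X2)) (E X1 X2)"
      if "X1 \<in> Ob S" "X2 \<in> Ob S" for X1 X2
      using that by (rule ext_functor)
    show "nat_iso (prod_cat (Fib H X1) (Fib H X2)) (Fib H (Prd P T1 T2))
        (E T1 T2 \<circ>\<^sub>F (Pull H f1 \<otimes>\<^sub>F Pull H f2)) (Pull H (prd_ar S P f1 f2) \<circ>\<^sub>F E X1 X2) (m f1 f2)"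
      if "f1 \<in> M" "f2 \<in> M" "f1 \<in> Hom S T1 X1" "f2 \<in> Hom S T2 X2" for f1 f2 T1 X1 T2 X2
      using two.coherent_cell[OF coh, of "(f1, f2)"] that by (auto simp: two.cell_def Hom_def)
    show "m (g1 \<cdot> f1) (g2 \<cdot> f2) (A1, A2) = two_step S P H E m m f1 f2 g1 g2 A1 A2"
      if "f1 \<in> M" "f2 \<in> M" "g1 \<in> M" "g2 \<in> M" "Cod S f1 = Dom S g1" "Cod S f2 = Dom S g2"
        "A1 \<in> Ob (Fib H (Cod S g1))" "A2 \<in> Ob (Fib H (Cod S g2))" for f1 f2 g1 g2 A1 A2
      using two.coherent_paste[OF coh, of "(f1, f2)" "(g1, g2)"] that by (simp add: paste_eq_two_step)
    show "m f1 f2 (A1, A2) = undefined"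
      if "\<not> (f1 \<in> M \<and> f2 \<in> M \<and> A1 \<in> Ob (Fib H (Cod S f1)) \<and> A2 \<in> Ob (Fib H (Cod S f2)))"
      for f1 f2 A1 A2
    proof (cases "f1 \<in> M \<and> f2 \<in> M")
      case True
      then show ?thesis using two.coherent_cell[OF coh, of "(f1, f2)"] that by (auto simp: two.cell_def)
    next
      case False
      then show ?thesis using two.coherent_undefined[OF coh, of "(f1, f2)"] by auto
    qed
  qed
qed

lemma comm_square_prod:
  "comm_square (prod_cat S S) (p1, p2) (h1, h2) (z1, z2) (q1, q2) \<longleftrightarrow>
    comm_square S p1 h1 z1 q1 \<and> comm_square S p2 h2 z2 q2"
  by (auto simp: comm_square_def)

text \<open>A commutative square in \<open>S \<times> S\<close> is a pair of commutative squares in \<open>S\<close>, so the exchange law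
  for cells over \<open>S \<times> S\<close> is the exchange condition of a skeleton.\<close>

lemma ext_tensor_skeleton_iff:
  assumes Sm: "wide_subcategory S Sm" and Cl: "wide_subcategory S Cl"
  shows "ext_tensor_skeleton S P H Sm Cl E msm mcl \<longleftrightarrow>
    two.coherent (Sm \<times> Sm) (case_prod msm) \<and> two.coherent (Cl \<times> Cl) (case_prod mcl) \<and>
    two.exchange_law (Sm \<times> Sm) (Cl \<times> Cl) (case_prod msm) (case_prod mcl)"
proof -
  have "two.exchange_law (Sm \<times> Sm) (Cl \<times> Cl) (case_prod msm) (case_prod mcl) \<longleftrightarrow>
    (\<forall>p1 h1 z1 q1 p2 h2 z2 q2 A1 A2.
      comm_square S p1 h1 z1 q1 \<longrightarrow> comm_square S p2 h2 z2 q2 \<longrightarrow>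
      p1 \<in> Sm \<longrightarrow> q1 \<in> Sm \<longrightarrow> z1 \<in> Cl \<longrightarrow> h1 \<in> Cl \<longrightarrow> p2 \<in> Sm \<longrightarrow> q2 \<in> Sm \<longrightarrow> z2 \<in> Cl \<longrightarrow> h2 \<in> Cl \<longrightarrow>
      A1 \<in> Ob (Fib H (Cod S p1)) \<longrightarrow> A2 \<in> Ob (Fib H (Cod S p2)) \<longrightarrow>
      two_step S P H E msm mcl q1 q2 z1 z2 A1 A2 = two_step S P H E mcl msm h1 h2 p1 p2 A1 A2)"
    (is "?l \<longleftrightarrow> ?r")
  proof
    assume ?l
    show ?r
    proof (intro allI impI)
      fix p1 h1 z1 q1 p2 h2 z2 q2 A1 A2
      assume sq: "comm_square S p1 h1 z1 q1" "comm_square S p2 h2 z2 q2"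
        and "p1 \<in> Sm" "q1 \<in> Sm" "z1 \<in> Cl" "h1 \<in> Cl" "p2 \<in> Sm" "q2 \<in> Sm" "z2 \<in> Cl" "h2 \<in> Cl"
        and A: "A1 \<in> Ob (Fib H (Cod S p1))" "A2 \<in> Ob (Fib H (Cod S p2))"
      then have "two.paste (q1, q2) (z1, z2) (msm q1 q2) (mcl z1 z2) (A1, A2)
          = two.paste (h1, h2) (p1, p2) (mcl h1 h2) (msm p1 p2) (A1, A2)"
        using \<open>?l\<close>[unfolded two.exchange_law_def, rule_format,
            of "(p1, p2)" "(h1, h2)" "(z1, z2)" "(q1, q2)"]
        by (simp add: comm_square_prod)
      then show "two_step S P H E msm mcl q1 q2 z1 z2 A1 A2
          = two_step S P H E mcl msm h1 h2 p1 p2 A1 A2"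
        using sq A by (simp add: paste_eq_two_step comm_square_def)
    qed
  next
    assume ?r
    show ?l
      unfolding two.exchange_law_def
    proof (intro allI impI ext)
      fix p h z q and A :: "'x \<times> 'x"
      assume *: "comm_square (prod_cat S S) p h z q" "p \<in> Sm \<times> Sm" "q \<in> Sm \<times> Sm"
        "z \<in> Cl \<times> Cl" "h \<in> Cl \<times> Cl"
      obtain p1 p2 h1 h2 z1 z2 q1 q2 A1 A2 where
        [simp]: "p = (p1, p2)" "h = (h1, h2)" "z = (z1, z2)" "q = (q1, q2)" "A = (A1, A2)"
        by fastforce
      have sq: "comm_square S p1 h1 z1 q1" "comm_square S p2 h2 z2 q2"
        using * by (auto simp: comm_square_prod)
      then have "Cod S p1 = Cod S z1" "Cod S p2 = Cod S z2" by (auto simp: comm_square_def)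
      then show "two.paste q z (case_prod msm q) (case_prod mcl z) A
          = two.paste h p (case_prod mcl h) (case_prod msm p) A"
        using \<open>?r\<close>[rule_format, OF sq, of A1 A2] * by (auto simp: paste_eq_two_step)
    qed
  qed
  then show ?thesis
    by (simp add: ext_tensor_skeleton_def ext_tensor_structure_iff_coherent[OF Sm]
        ext_tensor_structure_iff_coherent[OF Cl])
qed

lemma mon_restrict_eq: "case_prod (mon_restrict m M) = two.restrict_to (M \<times> M) (case_prod m)"
  by (auto simp: fun_eq_iff mon_restrict_def two.restrict_to_def)

lemma mon_restrict_eq_iff:
  "mon_restrict m M = n \<longleftrightarrow> two.restrict_to (M \<times> M) (case_prod m) = case_prod n"
  unfolding mon_restrict_eq[symmetric] by (simp add: fun_eq_iff)

end

lemma tensor_setting_intro: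
  assumes "category S" "binary_products S P" "fibered_category S H"
    and "ext_tensor_structure S P H M E m"
  shows "tensor_setting S P H E"
proof -
  interpret category S by fact
  interpret binary_products S P by fact
  interpret fibered_category S H by fact
  interpret ext_tensor_structure S P H M E m by fact
  show ?thesis by (intro tensor_setting.intro category_with_products.intro tensor_setting_axioms.intro
        assms(1-3) ext_functor)
qed

theorem proposition4p3:
  fixes S :: "('s, 'a) cat" and P :: "('s, 'a) prod_data" and Sm Cl :: "'a set"
    and H :: "('s, 'a, 'x, 'y) fib_cat"
  assumes "smooth_closed S Sm Cl" and "binary_products S P" and "fibered_category S H"
  shows "(\<forall>E m. ext_tensor_structure S P H (Ar S) E m \<longrightarrow>
            ext_tensor_skeleton S P H Sm Cl E (mon_restrict m Sm) (mon_restrict m Cl))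
    \<and> (\<forall>E msm mcl. ext_tensor_skeleton S P H Sm Cl E msm mcl \<longrightarrow>
            (\<exists>!m. ext_tensor_structure S P H (Ar S) E m \<and>
                  mon_restrict m Sm = msm \<and> mon_restrict m Cl = mcl))
    \<and> (smooth_adjointable S Sm H \<longrightarrow>
         (\<forall>L E m. left_adjoints S Sm H L \<longrightarrow> ext_tensor_structure S P H (Ar S) E m \<longrightarrow>
            (smooth_adjointable_tensor S P Sm H L E m \<longleftrightarrow>
             smooth_adjointable_skeleton S P Sm H L E (mon_restrict m Sm) (mon_restrict m Cl))))"
proof (intro conjI allI impI)
  interpret smooth_closed S Sm Cl by fact
  have category: "category S" by unfold_locales
  have Ar: "wide_subcategory S (Ar S)"
    by unfold_locales (use Idt_Hom Comp_Hom in \<open>auto simp: Hom_def\<close>)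
  note setting = tensor_setting_intro[OF category assms(2,3)]
  note factors = refinable_factorizations_prod[OF refinable_factorizations refinable_factorizations]
  {
    fix E m assume m: "ext_tensor_structure S P H (Ar S) E m"
    interpret tensor_setting S P H E by (rule setting[OF m])
    have coh: "two.coherent (Ar (prod_cat S S)) (case_prod m)"
      using m ext_tensor_structure_iff_coherent[OF Ar] by simp
    show "ext_tensor_skeleton S P H Sm Cl E (mon_restrict m Sm) (mon_restrict m Cl)"
      unfolding ext_tensor_skeleton_iff[OF Sm_sub Cl_sub] mon_restrict_eq
      by (intro conjI two.coherent_restrict[OF coh] two.exchange_restrict[OF coh]
          wide_subcategory_prod Sm_sub Cl_sub)
  next
    fix E msm mcl assume sk: "ext_tensor_skeleton S P H Sm Cl E msm mcl"
    interpret tensor_setting S P H E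
      by (rule setting[OF ext_tensor_skeleton.smooth_structure[OF sk]])
    interpret cell_extension "prod_cat S S" "pair_fibration H" "product_fibration S P H"
      "case_prod E" "Sm \<times> Sm" "Cl \<times> Cl" "case_prod msm" "case_prod mcl"
      using sk factors two.fibrewise_functors_axioms unfolding ext_tensor_skeleton_iff[OF Sm_sub Cl_sub]
      by (intro cell_extension.intro cell_extension_axioms.intro) auto
    have iff: "ext_tensor_structure S P H (Ar S) E m \<and> mon_restrict m Sm = msm \<and> mon_restrict m Cl = mcl
      \<longleftrightarrow> case_prod m = extension" for m
      using extends_iff_extension[of "case_prod m"]
      by (simp add: mon_restrict_eq_iff ext_tensor_structure_iff_coherent[OF Ar])
    show "\<exists>!m. ext_tensor_structure S P H (Ar S) E m \<and> mon_restrict m Sm = msm \<and> mon_restrict m Cl = mcl"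
      unfolding iff by (rule ex1I[of _ "curry extension"]) (simp, metis curry_case_prod)
  next
    fix L E m
    \<comment> \<open>Only the values of \<open>m\<close> at pairs of smooth arrows enter.\<close>
    show "smooth_adjointable_tensor S P Sm H L E m \<longleftrightarrow>
        smooth_adjointable_skeleton S P Sm H L E (mon_restrict m Sm) (mon_restrict m Cl)"
      by (simp add: smooth_adjointable_skeleton_def smooth_adjointable_tensor_def
          sharp_comparison_def mon_restrict_def)
  }
qed

end
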